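(* There exists a (non-empty) topological dynamical system $(X,T)$ with zero topological entropy which is everywhere non-invertible and which has a globally supported ergodic measure, that is, an ergodic $T$-invariant Borel probability measure $\mu$ on $X$ whose topological support is all of $X$.
   Context: A topological dynamical system $(X,T)$ is a continuous onto map $T:X\to X$ of a compact metric space $X$. It is everywhere non-invertible if every point $x\in X$ has multiple preimages, i.e. $|T^{-1}(x)|\geq 2$ for every $x\in X$. *)

theory Defs
  imports "HOL-Probability.Probability"
begin

text \<open>
  A space is a subset \<open>X\<close> of a metric space type, with the induced metric; a map
  \<open>T\<close> is a total function of which only the restriction to \<open>X\<close> is relevant.
\<close>

definition top_dyn_system :: "'a::metric_space set \<Rightarrow> ('a \<Rightarrow> 'a) \<Rightarrow> bool" where
  "top_dyn_system X T \<longleftrightarrow> compact X \<and> continuous_on X T \<and> T ` X = X"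

text \<open>
  Fibres may be infinite, where \<open>card\<close> is 0, so \<open>|T\<^sup>-\<^sup>1(x)| \<ge> 2\<close> is written with two
  distinct preimages.
\<close>

definition everywhere_noninvertible :: "'a set \<Rightarrow> ('a \<Rightarrow> 'a) \<Rightarrow> bool" where
  "everywhere_noninvertible X T \<longleftrightarrow>
     (\<forall>x\<in>X. \<exists>y\<in>X. \<exists>z\<in>X. y \<noteq> z \<and> T y = x \<and> T z = x)"

text \<open>
  Topological entropy in the form of Bowen and Dinaburg. The infimum below is
  \<open>(1/n) log r(n, \<epsilon>)\<close>, with \<open>r(n, \<epsilon>)\<close> the least cardinality of an
  \<open>(n, \<epsilon>)\<close>-spanning set; the limit as \<open>\<epsilon>\<close> tends to 0 is a supremum by monotonicity.
\<close>

definition spanning_set ::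
    "'a::metric_space set \<Rightarrow> ('a \<Rightarrow> 'a) \<Rightarrow> nat \<Rightarrow> real \<Rightarrow> 'a set \<Rightarrow> bool" where
  "spanning_set X T n \<epsilon> E \<longleftrightarrow>
     E \<subseteq> X \<and> (\<forall>x\<in>X. \<exists>y\<in>E. \<forall>i<n. dist ((T ^^ i) x) ((T ^^ i) y) \<le> \<epsilon>)"

definition topological_entropy :: "'a::metric_space set \<Rightarrow> ('a \<Rightarrow> 'a) \<Rightarrow> ereal" where
  "topological_entropy X T =
     (SUP \<epsilon>\<in>{0<..}. limsup (\<lambda>n.
        INF E\<in>{E. finite E \<and> spanning_set X T n \<epsilon> E}. ereal (ln (real (card E)) / real n)))"

definition borel_probability_on :: "'a::topological_space set \<Rightarrow> 'a measure \<Rightarrow> bool" where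
  "borel_probability_on X \<mu> \<longleftrightarrow> prob_space \<mu> \<and> space \<mu> = X \<and> sets \<mu> = sets (restrict_space borel X)"

definition invariant_measure :: "('a \<Rightarrow> 'a) \<Rightarrow> 'a measure \<Rightarrow> bool" where
  "invariant_measure T \<mu> \<longleftrightarrow> T \<in> measurable \<mu> \<mu> \<and> distr \<mu> \<mu> T = \<mu>"

definition ergodic_measure :: "('a \<Rightarrow> 'a) \<Rightarrow> 'a measure \<Rightarrow> bool" where
  "ergodic_measure T \<mu> \<longleftrightarrow> invariant_measure T \<mu> \<and>
     (\<forall>A\<in>sets \<mu>. T -` A \<inter> space \<mu> = A \<longrightarrow> measure \<mu> A = 0 \<or> measure \<mu> A = 1)"

definition topological_support :: "'a::topological_space set \<Rightarrow> 'a measure \<Rightarrow> 'a set" where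
  "topological_support X \<mu> = {x\<in>X. \<forall>U. open U \<and> x \<in> U \<longrightarrow> emeasure \<mu> (U \<inter> X) > 0}"

text \<open>
  Existence of a system is stated for compact subsets of \<open>nat \<Rightarrow> real\<close> with the product
  metric. This loses no generality: every compact metric space is homeomorphic to a
  compact subset of the Hilbert cube, and all notions above are invariant under
  homeomorphism of compact metric spaces.
\<close>

end

theory Submission
  imports Defs "HOL-Real_Asymp.Real_Asymp"
begin

text \<open>
  The system is the one-sided shift on the orbit closure of a real sequence with values in
  \<open>{0} \<union> {\<plusminus>1/m | m \<ge> 1}\<close>. Each position carries a level, and the sequence is arranged so that every
  word starting at a position of level \<open>l\<close> also occurs preceded by \<open>1/(l+1)\<close> and preceded by
  \<open>-1/(l+1)\<close>; the new positions in front have level \<open>l + 1\<close>. A point approximated by words of one fixed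
  level therefore has two preimages, and a point approximated only by words of levels tending to
  infinity is the zero sequence, which is also approximated at level 1. Going backwards the level
  increases along the newly created branches, so at each scale only boundedly many branchings are
  visible in a block, which makes the entropy vanish.

  The prepended words are created by modifying one of the \<open>2^(k+2)\<close> copies of the \<open>k\<close>-th block that
  make up the next block. These proportions are summable, so by Borel-Cantelli almost every point of
  the odometer of block positions reads off a well-defined sequence. The law of this sequence
  is a factor of the ergodic odometer, and it charges every word of the block sequence.
\<close>

section \<open>The block sequence\<close>

text \<open>At least 4, so that copy 0, the modified copy 1 and the last copy are distinct. The
  reciprocals sum to 1/2, which drives the almost sure convergence and leaves positive mass in
  \<open>prob_window_pos\<close>.\<close>

definition branching :: "nat \<Rightarrow> nat" where "branching k = 2 ^ (k + 2)"

primrec blen :: "nat \<Rightarrow> nat" where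
  "blen 0 = 1"
| "blen (Suc k) = branching k * blen k"

text \<open>
  The pair (target position, sign) attached to the block number \<open>k\<close> takes every value for
  infinitely many \<open>k\<close>; the extra component of the decoded pair is there to produce the repetitions.
\<close>

definition head_target :: "nat \<Rightarrow> nat" where
  "head_target k = fst (prod_decode (fst (prod_decode k)))"

definition head_sign :: "nat \<Rightarrow> real" where
  "head_sign k = (if even (snd (prod_decode (fst (prod_decode k)))) then 1 else -1)"

text \<open>
  The last block of length \<open>blen j\<close> inside a block of length \<open>blen (Suc j)\<close> is unmodified, so
  reading from position \<open>hlen (Suc j)\<close> on is the same as reading from position \<open>head_target (Suc j)\<close> on.
\<close>

definition hlen :: "nat \<Rightarrow> nat" where
  "hlen k = (case k of 0 \<Rightarrow> 0
     | Suc j \<Rightarrow> (branching j - 1) * blen j + (if head_target k < blen j then head_target k else 0))"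

text \<open>
  The block of length \<open>blen (Suc k)\<close> consists of \<open>branching k\<close> copies of the block of length \<open>blen k\<close>; in
  the copy number 1 the part before position \<open>hlen k\<close> is overwritten by zeros and a last symbol
  \<open>\<plusminus>1 / (l + 1)\<close>, where \<open>l\<close> is the level of position \<open>hlen k\<close>, and gets level \<open>l + 1\<close>.
\<close>

primrec block_level :: "nat \<Rightarrow> nat \<Rightarrow> nat" where
  "block_level 0 p = 0"
| "block_level (Suc k) p = (if p div blen k = 1 \<and> p mod blen k < hlen k then Suc (block_level k (hlen k))
                    else block_level k (p mod blen k))"

primrec block_symbol :: "nat \<Rightarrow> nat \<Rightarrow> real" where
  "block_symbol 0 p = 0"
| "block_symbol (Suc k) p = (if p div blen k = 1 \<and> p mod blen k < hlen k
     then (if Suc (p mod blen k) = hlen k then head_sign k / real (Suc (block_level k (hlen k))) else 0)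
     else block_symbol k (p mod blen k))"

text \<open>Block \<open>p\<close> reaches beyond position \<open>p\<close> because
  \<open>p < blen p\<close>, and later blocks repeat it as their copy 0, which is never overwritten.
  So this is the value at \<open>p\<close> of the infinite limit of the blocks.\<close>

definition level :: "nat \<Rightarrow> nat" where "level p = block_level p p"
definition seq :: "nat \<Rightarrow> real" where "seq p = block_symbol p p"

section \<open>Block lengths and the passage from blocks to the infinite sequence\<close>

lemma branching_ge: "4 \<le> branching k" "branching k > 0" "branching k > 1"
proof -
  have "(2::nat) ^ 2 \<le> 2 ^ (k + 2)" by (rule power_increasing) auto
  then show "4 \<le> branching k" by (simp add: branching_def)
  then show "branching k > 0" "branching k > 1" by auto
qed

lemma blen_pos [simp]: "blen k > 0"
  by (induction k) (auto simp: branching_ge)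

lemma blen_mono: "j \<le> k \<Longrightarrow> blen j \<le> blen k"
proof (rule lift_Suc_mono_le[of blen])
  fix n show "blen n \<le> blen (Suc n)" using branching_ge(2)[of n] by (cases "branching n") auto
qed

lemma blen_ge_power: "2 ^ k \<le> blen k"
proof (induction k)
  case (Suc k)
  have "2 * 2 ^ k \<le> branching k * blen k" by (rule mult_mono) (use Suc branching_ge[of k] in auto)
  then show ?case by simp
qed auto

lemma less_blen: "k < blen k"
  using blen_ge_power[of k] less_exp[of k] by linarith

lemma blen_dvd: "j \<le> k \<Longrightarrow> blen j dvd blen k"
  by (induction k rule: dec_induct) auto

lemma hlen_Suc: "hlen (Suc j) = (branching j - 1) * blen j + (if head_target (Suc j) < blen j then head_target (Suc j) else 0)"
  by (simp add: hlen_def)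

lemma hlen_0 [simp]: "hlen 0 = 0"
  by (simp add: hlen_def)

lemma hlen_less: "hlen k < blen k"
proof (cases k)
  case (Suc j)
  have "hlen k < (branching j - 1) * blen j + blen j" by (simp add: Suc hlen_Suc)
  also have "\<dots> = ((branching j - 1) + 1) * blen j" by (simp only: distrib_right mult_1)
  also have "\<dots> = blen k" using branching_ge[of j] by (simp add: Suc)
  finally show ?thesis .
qed auto

lemma lev_stable: assumes "p < blen k" "k \<le> j" shows "block_level j p = block_level k p" "block_symbol j p = block_symbol k p"
proof -
  have "block_level j p = block_level k p \<and> block_symbol j p = block_symbol k p" using assms(2)
  proof (induction j rule: dec_induct)
    case (step n)
    then have "p < blen n" using assms(1) blen_mono[of k n] by auto
    then show ?case using step by simp
  qed auto
  then show "block_level j p = block_level k p" "block_symbol j p = block_symbol k p" by auto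
qed

lemma level_eq: assumes "p < blen k" shows "block_level k p = level p" "block_symbol k p = seq p"
proof -
  have *: "p < blen (min k p)" using assms less_blen[of p] by (auto simp: min_def)
  have "block_level k p = block_level (min k p) p" "block_symbol k p = block_symbol (min k p) p"
    using lev_stable[OF *, of k] by auto
  moreover have "block_level p p = block_level (min k p) p" "block_symbol p p = block_symbol (min k p) p"
    using lev_stable[OF *, of p] by auto
  ultimately show "block_level k p = level p" "block_symbol k p = seq p" by (auto simp: level_def seq_def)
qed

lemma block_less: assumes "a < blen k" "c < branching k" shows "c * blen k + a < blen (Suc k)"
proof -
  have "c * blen k + a < c * blen k + blen k" using assms by simp
  also have "\<dots> = Suc c * blen k" by simp
  also have "\<dots> \<le> branching k * blen k" using assms(2) by (intro mult_right_mono) auto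
  finally show ?thesis by simp
qed

text \<open>Turns the recursion on blocks into a self-similarity of the infinite sequence, the form
  in which levels are computed from here on.\<close>

lemma level_block:
  assumes "a < blen k" "c < branching k"
  shows "level (c * blen k + a) = (if c = 1 \<and> a < hlen k then Suc (level (hlen k)) else level a)"
proof -
  have "block_level (Suc k) (c * blen k + a) = level (c * blen k + a)" by (rule level_eq) (rule block_less[OF assms])
  moreover have "(c * blen k + a) div blen k = c" "(c * blen k + a) mod blen k = a" using assms by auto
  ultimately show ?thesis
    by (simp only: block_level.simps level_eq(1)[OF hlen_less] level_eq(1)[OF assms(1)])
qed

lemma seq_block:
  assumes "a < blen k" "c < branching k"
  shows "seq (c * blen k + a) = (if c = 1 \<and> a < hlen k
     then (if Suc a = hlen k then head_sign k / real (Suc (level (hlen k))) else 0) else seq a)"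
proof -
  have "block_symbol (Suc k) (c * blen k + a) = seq (c * blen k + a)" by (rule level_eq) (rule block_less[OF assms])
  moreover have "(c * blen k + a) div blen k = c" "(c * blen k + a) mod blen k = a" using assms by auto
  ultimately show ?thesis
    by (simp only: block_symbol.simps level_eq(1)[OF hlen_less] level_eq(2)[OF assms(1)])
qed

lemma block_decomp:
  assumes "p < blen (Suc k)"
  obtains c a where "p = c * blen k + a" "a < blen k" "c < branching k"
proof
  show "p = (p div blen k) * blen k + p mod blen k" by simp
  show "p mod blen k < blen k" by simp
  show "p div blen k < branching k" using assms by (simp add: less_mult_imp_div_less)
qed

section \<open>Levels and symbols along the sequence\<close>

lemma level_0 [simp]: "level 0 = 0"
  by (simp add: level_def)

text \<open>The overwritten part stops strictly before the end of a block, and the last copy is not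
  copy 1. This settles the crossing between copies in \<open>level_step\<close>.\<close>

lemma level_last: "level (blen k - 1) = 0"
proof (induction k)
  case (Suc k)
  have "blen (Suc k) - 1 = (branching k - 1) * blen k + (blen k - 1)"
    using branching_ge(2)[of k] blen_pos[of k] by (cases "branching k") (auto simp del: blen_pos)
  moreover have "level \<dots> = level (blen k - 1)"
    by (subst level_block) (use branching_ge[of k] in auto)
  ultimately show ?case using Suc by simp
qed auto

text \<open>An overwritten part has constant level, one above the level at \<open>hlen k\<close>
  where it ends; elsewhere the bound is inherited from a smaller block, and block ends have level 0
  by \<open>level_last\<close>.\<close>

lemma level_step: "level p \<le> Suc (level (Suc p))"
proof -
  have "Suc p < blen k \<longrightarrow> level p \<le> Suc (level (Suc p))" for k
  proof (induction k arbitrary: p)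
    case (Suc k)
    show ?case
    proof
      assume less: "Suc p < blen (Suc k)"
      then obtain c a where p: "p = c * blen k + a" "a < blen k" "c < branching k"
        using block_decomp[of p k] by (metis Suc_lessD)
      show "level p \<le> Suc (level (Suc p))"
      proof (cases "Suc a < blen k")
        case True
        have s: "Suc p = c * blen k + Suc a" using p by simp
        show ?thesis unfolding s unfolding p(1) level_block[OF p(2,3)] level_block[OF True p(3)]
          using Suc[of a] True by (auto simp: le_less_Suc_eq not_less dest: le_antisym)
      next
        case False
        then have a: "a = blen k - 1" using p(2) by simp
        have "a \<ge> hlen k" using a hlen_less[of k] by simp
        then show ?thesis unfolding p(1) level_block[OF p(2,3)] using level_last[of k] a by simp
      qed
    qed
  qed auto
  then show ?thesis using less_blen[of "Suc p"] by blast
qed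

lemma level_add: "level p \<le> i + level (p + i)"
proof (induction i)
  case (Suc i)
  then show ?case using level_step[of "p + i"] by simp
qed simp

lemma abs_head_sign [simp]: "\<bar>head_sign k\<bar> = 1"
  by (simp add: head_sign_def)

text \<open>A nonzero symbol enters the sequence together with its level \<open>l + 1\<close>, with
  modulus \<open>1 / (l + 1)\<close>, and copying preserves both.\<close>

lemma seq_cases: "seq p = 0 \<or> level p > 0 \<and> \<bar>seq p\<bar> = 1 / real (level p)"
proof -
  have "p < blen k \<longrightarrow> seq p = 0 \<or> level p > 0 \<and> \<bar>seq p\<bar> = 1 / real (level p)" for k
  proof (induction k arbitrary: p)
    case 0
    show ?case by (auto simp: seq_def)
  next
    case (Suc k)
    show ?case
    proof
      assume "p < blen (Suc k)"
      then obtain c a where p: "p = c * blen k + a" "a < blen k" "c < branching k"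
        using block_decomp[of p k] by metis
      show "seq p = 0 \<or> level p > 0 \<and> \<bar>seq p\<bar> = 1 / real (level p)"
        unfolding p(1) level_block[OF p(2,3)] seq_block[OF p(2,3)]
        using Suc[of a] p by (simp add: abs_divide)
    qed
  qed
  then show ?thesis using less_blen by blast
qed

lemma seq_bounded: "\<bar>seq p\<bar> \<le> 1"
  using seq_cases[of p] by auto

section \<open>Prepended words and windows of zeros\<close>

lemma ex_head:
  assumes "s = 1 \<or> s = -1"
  shows "\<exists>j. n \<le> j \<and> p < blen j \<and> hlen (Suc j) = (branching j - 1) * blen j + p \<and> head_sign (Suc j) = s"
proof -
  define b :: nat where "b = (if s = 1 then 0 else 1)"
  \<comment> \<open>Decoding target and sign discards the second component, which makes
    \<open>k\<close> exceed \<open>n + p\<close>: block \<open>j = k - 1\<close> then contains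
    \<open>p\<close>, so \<open>hlen k\<close> does not fall back to target 0.\<close>
  define k where "k = prod_encode (prod_encode (p, b), Suc (n + p))"
  have "Suc (n + p) \<le> k" unfolding k_def by (rule le_prod_encode_2)
  then obtain j where j: "k = Suc j" "n \<le> j" "p \<le> j" by (cases k) auto
  have "p < blen j" using less_blen[of j] j by simp
  moreover have "head_target k = p" "head_sign k = s" using assms by (auto simp: head_target_def head_sign_def k_def b_def)
  ultimately show ?thesis using j hlen_Suc[of j] by (intro exI[of _ j]) auto
qed

text \<open>Block \<open>Suc j\<close> ends with an unmodified copy of block \<open>j\<close>, so
  the window at \<open>p\<close> recurs at \<open>hlen (Suc j)\<close>. In copy 1 of block
  \<open>Suc j\<close> it survives there, right behind the inserted symbol.\<close>

lemma seq_prepend: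
  assumes "s = 1 \<or> s = -1"
  shows "\<exists>p'. seq p' = s / real (Suc (level p)) \<and> (\<forall>i<n. seq (Suc p' + i) = seq (p + i))"
proof -
  obtain j where j: "p + n \<le> j" "p < blen j" "hlen (Suc j) = (branching j - 1) * blen j + p" "head_sign (Suc j) = s"
    using ex_head[OF assms] by blast
  have pn: "p + n < blen j" using less_blen[of j] j by simp
  let ?k = "Suc j" let ?c = "branching j - 1"
  have c: "?c < branching j" "?c \<noteq> 1" using branching_ge[of j] by auto
  have 1: "1 < branching ?k" using branching_ge[of ?k] by simp
  have block_level: "level (hlen ?k) = level p" unfolding j(3) using level_block[OF j(2) c(1)] c by simp
  have "?c * blen j > 0" using branching_ge[of j] by simp
  then have hpos: "hlen ?k > 0" using j by simp
  \<comment> \<open>Last overwritten position in copy 1 of block \<open>Suc j\<close>, hence the one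
    carrying the new symbol.\<close>
  define p' where "p' = 1 * blen ?k + (hlen ?k - 1)"
  have "seq p' = s / real (Suc (level p))"
    unfolding p'_def by (subst seq_block[OF _ 1]) (use hlen_less[of ?k] hpos block_level j in auto)
  moreover have "seq (Suc p' + i) = seq (p + i)" if "i < n" for i
  proof -
    have pi: "p + i < blen j" using pn that by simp
    have hi: "hlen ?k + i = ?c * blen j + (p + i)" using j by simp
    have "hlen ?k + i < blen ?k" unfolding hi by (rule block_less[OF pi c(1)])
    moreover have "Suc p' + i = 1 * blen ?k + (hlen ?k + i)" using hpos by (simp add: p'_def)
    ultimately have "seq (Suc p' + i) = seq (hlen ?k + i)" using seq_block[OF _ 1, of "hlen ?k + i"]
      by (simp only: not_add_less1 simp_thms if_False)
    also have "\<dots> = seq (p + i)" unfolding hi using seq_block[OF pi c(1)] c by simp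
    finally show ?thesis .
  qed
  ultimately show ?thesis by blast
qed

text \<open>A head with target 0 ends where the level is 0, so the overwritten part has level 1; it
  is long and vanishes except at its end. It supplies the zero sequence with approximations of one
  fixed level.\<close>

lemma zero_window: "\<exists>p. level p = 1 \<and> (\<forall>i<n. seq (p + i) = 0)"
proof -
  obtain j where j: "Suc n \<le> j" "hlen (Suc j) = (branching j - 1) * blen j"
    using ex_head[of 1 "Suc n" 0] by auto
  let ?k = "Suc j"
  have 1: "1 < branching ?k" using branching_ge[of ?k] by simp
  have block_level: "level (hlen ?k) = 0"
    using level_block[of 0 j "branching j - 1"] branching_ge[of j] j by simp
  have "1 * blen j \<le> (branching j - 1) * blen j" using branching_ge[of j] by (intro mult_right_mono) auto
  then have hlen: "Suc n < hlen ?k" using j less_blen[of j] by linarith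
  have "level (1 * blen ?k + 0) = 1" using level_block[OF blen_pos 1] hlen block_level by simp
  moreover have "seq (1 * blen ?k + i) = 0" if "i < n" for i
    using seq_block[OF _ 1, of i] hlen hlen_less[of ?k] that by simp
  ultimately show ?thesis by (intro exI[of _ "blen ?k"]) simp
qed

text \<open>
  Up to some position the levels in a block can only drop, and they do drop after every nonzero
  symbol; beyond it the block is the initial one. As \<open>\<bar>seq p\<bar> = 1 / level p\<close> for nonzero symbols,
  at most \<open>N\<close> symbols of the first part have modulus at least \<open>1 / N\<close>.
\<close>

lemma seq_block_shape:
  "\<exists>t \<le> blen k. (\<forall>a. t \<le> a \<longrightarrow> a < blen k \<longrightarrow> seq (c * blen k + a) = seq a) \<and>
     (\<forall>a b. a < b \<longrightarrow> b < t \<longrightarrow> level (c * blen k + b) \<le> level (c * blen k + a) \<and>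
        (seq (c * blen k + a) \<noteq> 0 \<longrightarrow> level (c * blen k + b) < level (c * blen k + a)))"
  (is "\<exists>t \<le> blen k. ?A (c * blen k) t \<and> ?B (c * blen k) t")
proof -
  \<comment> \<open>Generalised to every multiple \<open>P\<close> of \<open>blen k\<close>, by
    induction on the initial block that contains \<open>P\<close>. The base is \<open>P = 0\<close>
    with \<open>t = 0\<close>.\<close>
  have "P < blen j \<longrightarrow> blen k dvd P \<longrightarrow> (\<exists>t \<le> blen k. ?A P t \<and> ?B P t)" if "k \<le> j" for j P
    using that
  proof (induction j arbitrary: P rule: dec_induct)
    case base
    have "P < blen k \<Longrightarrow> blen k dvd P \<Longrightarrow> P = 0" by (meson dvd_imp_le leD not_gr0)
    then show ?case by (intro impI exI[of _ 0]) auto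
  next
    case (step j)
    show ?case
    proof (intro impI)
      assume P: "P < blen (Suc j)" "blen k dvd P"
      obtain e r where e: "P = e * blen j + r" "r < blen j" "e < branching j"
        using block_decomp[OF P(1)] by metis
      have dvdj: "blen k dvd blen j" using step by (simp add: blen_dvd)
      then have dr: "blen k dvd r" using P(2) e(1) by (metis dvd_add_right_iff dvd_mult)
      then obtain t where t: "t \<le> blen k" "?A r t" "?B r t" using step.IH e(2) by blast
      have ra: "r + a < blen j" if "a < blen k" for a
      proof -
        obtain u v where u: "blen j = blen k * u" "r = blen k * v" using dvdj dr by (auto elim!: dvdE)
        then have "v < u" using e(2) by simp
        then have "blen k * Suc v \<le> blen k * u" by (intro mult_left_mono) auto
        then show ?thesis using u that by simp
      qed
      have lv: "level (P + a) = (if e = 1 \<and> r + a < hlen j then Suc (level (hlen j)) else level (r + a))"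
        and sq: "seq (P + a) = (if e = 1 \<and> r + a < hlen j
           then (if Suc (r + a) = hlen j then head_sign j / real (Suc (level (hlen j))) else 0) else seq (r + a))"
        if "a < blen k" for a
        using level_block[OF ra[OF that] e(3)] seq_block[OF ra[OF that] e(3)]
        by (simp_all add: e(1) add.assoc)
      show "\<exists>t \<le> blen k. ?A P t \<and> ?B P t"
      proof (cases "e = 1 \<and> r < hlen j")
        case False
        then have "level (P + a) = level (r + a)" "seq (P + a) = seq (r + a)" if "a < blen k" for a
          using lv[OF that] sq[OF that] by auto
        then show ?thesis using t by (intro exI[of _ t]) auto
      next
        case True
        \<comment> \<open>\<open>u\<close> is the length of the overwritten part of the
          \<open>k\<close>-block at \<open>P\<close>; behind it the shape of the block at
          \<open>r\<close> takes over.\<close>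
        define u where "u = min (blen k) (hlen j - r)"
        define t' where "t' = max u t"
        have t': "t' \<le> blen k" using t by (auto simp: t'_def u_def)
        have "?A P t'" using t True sq by (auto simp: t'_def u_def)
        moreover have "?B P t'"
        proof (intro allI impI)
          fix a b assume ab: "a < b" "b < t'"
          then have blen: "a < blen k" "b < blen k" using t' by auto
          consider "r + b < hlen j" | "r + a < hlen j" "hlen j \<le> r + b" | "hlen j \<le> r + a" by linarith
          then show "level (P + b) \<le> level (P + a) \<and>
            (seq (P + a) \<noteq> 0 \<longrightarrow> level (P + b) < level (P + a))"
          proof cases
            case 1
            then show ?thesis using lv[OF blen(1)] lv[OF blen(2)] sq[OF blen(1)] ab True by auto
          next
            case 2
            have bt: "b < t" using ab 2 blen by (auto simp: t'_def u_def)
            have hlen: "hlen j = r + (hlen j - r)" "hlen j - r \<le> b" using True 2 by auto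
            \<comment> \<open>Here \<open>a\<close> is overwritten and \<open>b\<close> is not. The
              induction hypothesis compares \<open>b\<close> with \<open>hlen j - r\<close>, and the
              overwritten level exceeds that of \<open>hlen j\<close> by one, which gives the strict
              drop.\<close>
            have "level (r + b) \<le> level (hlen j)"
              using t(3) bt hlen by (metis le_neq_implies_less order_refl)
            then show ?thesis using lv[OF blen(1)] lv[OF blen(2)] sq[OF blen(1)] ab True 2 by auto
          next
            case 3
            then have bt: "b < t" using ab blen by (auto simp: t'_def u_def)
            have "level (P + a) = level (r + a)" "seq (P + a) = seq (r + a)"
              "level (P + b) = level (r + b)"
              using 3 ab lv[OF blen(1)] lv[OF blen(2)] sq[OF blen(1)] by auto
            then show ?thesis using t(3) ab bt by auto
          qed
        qed
        ultimately show ?thesis using t' by blast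
      qed
    qed
  qed
  moreover have "k \<le> k + c * blen k" "c * blen k < blen (k + c * blen k)"
    using less_blen[of "k + c * blen k"] by auto
  ultimately show ?thesis by (meson dvd_triv_right)
qed

section \<open>The orbit closure\<close>

definition shift :: "(nat \<Rightarrow> real) \<Rightarrow> nat \<Rightarrow> real" where "shift z = (\<lambda>n. z (Suc n))"

definition tail_from :: "nat \<Rightarrow> nat \<Rightarrow> real" where "tail_from p = (\<lambda>n. seq (p + n))"

definition shift_space :: "(nat \<Rightarrow> real) set" where "shift_space = closure (range tail_from)"

lemma funpow_shift: "(shift ^^ i) z = (\<lambda>n. z (n + i))"
  by (induction i) (auto simp: shift_def)

lemma dist_window:
  fixes e :: real
  assumes "e > 0"
  shows "\<exists>J. \<exists>\<delta>>0. \<forall>x y :: nat \<Rightarrow> real. (\<forall>i<J. \<bar>x i - y i\<bar> \<le> \<delta>) \<longrightarrow> dist x y \<le> e"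
proof -
  obtain N where N: "(1/2::real) ^ N < e / 2"
    using real_arch_pow_inv[of "e/2" "1/2"] assms by auto
  \<comment> \<open>The product metric orders coordinates by \<open>from_nat\<close>, so
    \<open>J\<close> must bound the indices of its first \<open>N + 1\<close> terms.\<close>
  define J where "J = Suc (Max ((from_nat :: nat \<Rightarrow> nat) ` {..N}))"
  have J: "from_nat n < J" if "n \<le> N" for n
    unfolding J_def using that by (intro le_imp_less_Suc Max_ge) auto
  show ?thesis
  \<comment> \<open>The distance is at most twice the largest of these terms plus
    \<open>(1/2) ^ N\<close>; either summand is at most \<open>e / 2\<close>.\<close>
  proof (intro exI[of _ J] exI[of _ "e/4"] conjI allI impI)
    fix x y :: "nat \<Rightarrow> real" assume xy: "\<forall>i<J. \<bar>x i - y i\<bar> \<le> e/4"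
    have "Max {dist (x (from_nat n)) (y (from_nat n)) |n. n \<le> N} \<le> e/4"
      by (rule Max.boundedI) (use xy J in \<open>auto simp: dist_real_def\<close>)
    then show "dist x y \<le> e"
      using dist_fun_le_dist_first_terms[of x y N] N by linarith
  qed (use assms in auto)
qed

lemma open_window:
  fixes U :: "(nat \<Rightarrow> real) set"
  assumes "open U" "x \<in> U"
  shows "\<exists>J. \<exists>\<delta>>0. \<forall>y. (\<forall>i<J. \<bar>y i - x i\<bar> \<le> \<delta>) \<longrightarrow> y \<in> U"
proof -
  obtain e where e: "e > 0" "\<And>y. dist y x < e \<Longrightarrow> y \<in> U" using assms open_dist by metis
  obtain J \<delta> where "\<delta> > 0" "\<And>x y :: nat \<Rightarrow> real. (\<forall>i<J. \<bar>x i - y i\<bar> \<le> \<delta>) \<Longrightarrow> dist x y \<le> e / 2"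
    using dist_window[of "e/2"] e by auto
  moreover have "e / 2 < e" using e by simp
  ultimately show ?thesis using e(2) by (meson le_less_trans)
qed

lemma shift_space_iff: "x \<in> shift_space \<longleftrightarrow> (\<forall>n. \<forall>e>0. \<exists>p. \<forall>i<n. \<bar>seq (p + i) - x i\<bar> < e)"
proof
  assume x: "x \<in> shift_space"
  show "\<forall>n. \<forall>e>0. \<exists>p. \<forall>i<n. \<bar>seq (p + i) - x i\<bar> < e"
  proof (intro allI impI)
    fix n and e :: real assume "e > 0"
    define U where "U = (\<Inter>i\<in>{..<n}. {y. \<bar>y i - x i\<bar> < e})"
    have "open {y :: nat \<Rightarrow> real. \<bar>y i - x i\<bar> < e}" for i
      by (intro open_Collect_less continuous_intros continuous_on_product_coordinates)
    then have "open U" unfolding U_def by (intro open_INT) auto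
    moreover have "x \<in> U" using \<open>e > 0\<close> by (simp add: U_def)
    ultimately have "U \<inter> range tail_from \<noteq> {}"
      using x open_Int_closure_eq_empty[of U "range tail_from"] unfolding shift_space_def by blast
    then obtain p where "tail_from p \<in> U" by blast
    then show "\<exists>p. \<forall>i<n. \<bar>seq (p + i) - x i\<bar> < e" by (auto simp: tail_from_def U_def)
  qed
next
  assume *: "\<forall>n. \<forall>e>0. \<exists>p. \<forall>i<n. \<bar>seq (p + i) - x i\<bar> < e"
  show "x \<in> shift_space" unfolding shift_space_def closure_approachable
  proof (intro allI impI)
    fix e :: real assume "e > 0"
    then obtain J \<delta> where J: "\<delta> > 0"
      "\<And>x y :: nat \<Rightarrow> real. (\<forall>i<J. \<bar>x i - y i\<bar> \<le> \<delta>) \<Longrightarrow> dist x y \<le> e / 2"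
      using dist_window[of "e/2"] by auto
    then obtain p where "\<forall>i<J. \<bar>seq (p + i) - x i\<bar> < \<delta>" using * by blast
    then have "dist (tail_from p) x \<le> e / 2" by (intro J(2)) (auto simp: tail_from_def intro: less_imp_le)
    then show "\<exists>y\<in>range tail_from. dist y x < e" using \<open>e > 0\<close> by (intro bexI[of _ "tail_from p"]) auto
  qed
qed

lemma shift_space_closed: "closed shift_space"
  by (simp add: shift_space_def)

lemma tail_from_in_shift_space: "tail_from p \<in> shift_space"
  unfolding shift_space_def by (rule subsetD[OF closure_subset rangeI])

text \<open>Symbols lie in \<open>{-1..1}\<close>, so the orbit closure is a closed subset of a cube
  that is compact by Tychonoff.\<close>

lemma shift_space_compact: "compact shift_space"
proof -
  define K where "K = PiE UNIV (\<lambda>_::nat. {-1..1::real})"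
  have "compactin (product_topology (\<lambda>_. euclidean) UNIV) K"
    unfolding K_def
  proof (rule iffD2[OF compactin_PiE], rule disjI2, rule ballI)
    show "compactin euclidean {-1..1::real}" unfolding compactin_euclidean_iff by (rule compact_Icc)
  qed
  then have K: "compact K"
    unfolding euclidean_product_topology compactin_euclidean_iff .
  have "tail_from p i \<in> {-1..1}" for p i
    using seq_bounded[of "p + i"] by (simp add: tail_from_def abs_le_iff)
  then have "range tail_from \<subseteq> K" unfolding K_def by (intro image_subsetI PiE_I) auto
  then have "shift_space \<subseteq> K" unfolding shift_space_def using compact_imp_closed[OF K] by (rule closure_minimal)
  then have "K \<inter> shift_space = shift_space" by (simp add: inf.absorb2)
  then show ?thesis using compact_Int_closed[OF K shift_space_closed] by simp
qed

section \<open>The shift on the orbit closure and its preimages\<close>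

lemma continuous_shift: "continuous_on A shift"
  unfolding shift_def
  by (intro continuous_on_coordinatewise_then_product
      continuous_on_subset[OF continuous_on_product_coordinates] subset_UNIV)

lemma shift_in_shift_space: assumes "x \<in> shift_space" shows "shift x \<in> shift_space"
  unfolding shift_space_iff
proof (intro allI impI)
  fix n and e :: real assume "e > 0"
  then obtain p where p: "\<forall>i<Suc n. \<bar>seq (p + i) - x i\<bar> < e" using assms shift_space_iff by blast
  then have "\<forall>i<n. \<bar>seq (Suc p + i) - shift x i\<bar> < e" by (auto simp: shift_def)
  then show "\<exists>p. \<forall>i<n. \<bar>seq (p + i) - shift x i\<bar> < e" by blast
qed

text \<open>The approximating positions share one level, so \<open>seq_prepend\<close> puts the same
  symbol in front of each of them.\<close>

lemma prepend_in_shift_space: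
  assumes s: "s = 1 \<or> s = -1"
    and app: "\<And>n e. e > 0 \<Longrightarrow> \<exists>p. level p = l \<and> (\<forall>i<n. \<bar>seq (p + i) - x i\<bar> < e)"
  shows "case_nat (s / real (Suc l)) x \<in> shift_space"
  unfolding shift_space_iff
proof (intro allI impI)
  fix n and e :: real assume e: "e > 0"
  then obtain p where p: "level p = l" "\<forall>i<n. \<bar>seq (p + i) - x i\<bar> < e" using app by blast
  obtain p' where p': "seq p' = s / real (Suc l)" "\<forall>i<n. seq (Suc p' + i) = seq (p + i)"
    using seq_prepend[OF s, of p n] p by auto
  have "\<bar>seq (p' + i) - case_nat (s / real (Suc l)) x i\<bar> < e" if "i < n" for i
    using that p p' e by (cases i) auto
  then show "\<exists>p. \<forall>i<n. \<bar>seq (p + i) - case_nat (s / real (Suc l)) x i\<bar> < e" by blast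
qed

text \<open>Take windows \<open>P N\<close> of growing length and accuracy. Either some level recurs
  infinitely often among them and can be kept, or the levels escape to infinity, which forces
  \<open>x\<close> to be zero and lets \<open>zero_window\<close> supply level 1.\<close>

lemma approximable_by_one_level:
  assumes "x \<in> shift_space"
  shows "\<exists>l. \<forall>n. \<forall>e>0. \<exists>p. level p = l \<and> (\<forall>i<n. \<bar>seq (p + i) - x i\<bar> < e)"
proof -
  have "\<forall>N. \<exists>p. \<forall>i<N. \<bar>seq (p + i) - x i\<bar> < 1 / real (Suc N)"
    using assms unfolding shift_space_iff by simp
  then obtain P where P: "\<And>N i. i < N \<Longrightarrow> \<bar>seq (P N + i) - x i\<bar> < 1 / real (Suc N)" by metis
  have close: "\<forall>i<n. \<bar>seq (P N + i) - x i\<bar> < e" if "n \<le> N" "1 / real (Suc N) < e" for n N e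
  proof (intro allI impI)
    fix i assume "i < n"
    then have "\<bar>seq (P N + i) - x i\<bar> < 1 / real (Suc N)" using that by (intro P) simp
    then show "\<bar>seq (P N + i) - x i\<bar> < e" using that by linarith
  qed
  show ?thesis
  proof (cases "\<exists>l. \<exists>\<^sub>\<infinity>N. level (P N) = l")
    case True
    then obtain l where l: "\<exists>\<^sub>\<infinity>N. level (P N) = l" by blast
    show ?thesis
    proof (rule exI[of _ l], intro allI impI)
      fix n and e :: real assume "e > 0"
      then obtain M where M: "1 / real (Suc M) < e" using nat_approx_posE[of e] by blast
      obtain N where N: "N > max n M" "level (P N) = l" using l unfolding INFM_nat by blast
      have "1 / real (Suc N) \<le> 1 / real (Suc M)" using N by (intro divide_left_mono) auto
      then show "\<exists>p. level p = l \<and> (\<forall>i<n. \<bar>seq (p + i) - x i\<bar> < e)"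
        using close[of n N e] N M by auto
    qed
  next
    case False
    \<comment> \<open>Levels tend to infinity along the approximating windows, and a level drops by at most one per step.\<close>
    have zero: "x i = 0" for i
    proof (rule ccontr)
      assume "x i \<noteq> 0"
      \<comment> \<open>Half of the modulus, because two quantities of size at most
        \<open>1 / Suc m\<close> are added: the symbol and the approximation error.\<close>
      then obtain m where m: "1 / real (Suc m) < \<bar>x i\<bar> / 2" using nat_approx_posE[of "\<bar>x i\<bar> / 2"]
        by (metis half_gt_zero zero_less_abs_iff)
      have "\<forall>\<^sub>\<infinity>N. level (P N) \<noteq> l" for l
        using False by (simp add: not_INFM)
      then have "\<forall>\<^sub>\<infinity>N. \<forall>l\<in>{..m + i}. level (P N) \<noteq> l"
        by (intro eventually_ball_finite) (auto simp: cofinite_eq_sequentially)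
      then obtain N0 where "\<And>N. N > N0 \<Longrightarrow> \<forall>l\<in>{..m + i}. level (P N) \<noteq> l"
        unfolding MOST_nat by blast
      then have big: "level (P N) > m + i" if "N > N0" for N using that
        by (metis atMost_iff not_le_imp_less)
      \<comment> \<open>Large enough that the level still exceeds \<open>m\<close> after
        \<open>i\<close> steps, that coordinate \<open>i\<close> is covered and that the error is at
        most \<open>1 / Suc m\<close>.\<close>
      define N where "N = Suc (N0 + i + m)"
      have "level (P N + i) > m"
        using level_add[of "P N" i] big[of N] by (simp add: N_def)
      then have "\<bar>seq (P N + i)\<bar> \<le> 1 / real (Suc m)"
        using seq_cases[of "P N + i"] by (auto intro!: divide_left_mono)
      moreover have "1 / real (Suc N) \<le> 1 / real (Suc m)" by (simp add: N_def frac_le)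
      moreover have "\<bar>seq (P N + i) - x i\<bar> < 1 / real (Suc N)" by (rule P) (simp add: N_def)
      ultimately show False using m by linarith
    qed
    show ?thesis
    proof (rule exI[of _ 1], intro allI impI)
      fix n and e :: real assume "e > 0"
      then show "\<exists>p. level p = 1 \<and> (\<forall>i<n. \<bar>seq (p + i) - x i\<bar> < e)"
        using zero_window[of n] zero by auto
    qed
  qed
qed

lemma shift_space_noninvertible: "everywhere_noninvertible shift_space shift"
  unfolding everywhere_noninvertible_def
proof
  fix x assume "x \<in> shift_space"
  then obtain l where l: "\<And>n e. e > 0 \<Longrightarrow> \<exists>p. level p = l \<and> (\<forall>i<n. \<bar>seq (p + i) - x i\<bar> < e)"
    using approximable_by_one_level by blast
  define y z where "y = case_nat (1 / real (Suc l)) x" and "z = case_nat (-1 / real (Suc l)) x"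
  have "y \<in> shift_space" "z \<in> shift_space"
    unfolding y_def z_def by (rule prepend_in_shift_space; simp add: l)+
  moreover have "y 0 \<noteq> z 0" by (simp add: y_def z_def field_simps)
  then have "y \<noteq> z" by auto
  moreover have "shift y = x" "shift z = x" by (auto simp: shift_def y_def z_def)
  ultimately show "\<exists>y\<in>shift_space. \<exists>z\<in>shift_space. y \<noteq> z \<and> shift y = x \<and> shift z = x" by blast
qed

lemma shift_space_system: "top_dyn_system shift_space shift"
proof -
  have "shift ` shift_space = shift_space"
  proof
    show "shift ` shift_space \<subseteq> shift_space" using shift_in_shift_space by blast
    \<comment> \<open>Surjectivity is contained in everywhere non-invertibility.\<close>
    show "shift_space \<subseteq> shift ` shift_space" using shift_space_noninvertible unfolding everywhere_noninvertible_def
      by (metis image_eqI subsetI)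
  qed
  then show ?thesis using shift_space_compact continuous_shift by (simp add: top_dyn_system_def)
qed

section \<open>Entropy\<close>

definition round_small :: "real \<Rightarrow> real \<Rightarrow> real" where
  "round_small e v = (if \<bar>v\<bar> \<le> e then 0 else v)"

lemma round_small_eqD: "e \<ge> 0 \<Longrightarrow> round_small e u = round_small e v \<Longrightarrow> \<bar>u - v\<bar> \<le> 2 * e"
  by (auto simp: round_small_def split: if_splits)

text \<open>Padding by 0 makes equality of functions the same as equality of rounded words.\<close>

definition rounded_block :: "real \<Rightarrow> nat \<Rightarrow> nat \<Rightarrow> nat \<Rightarrow> real" where
  "rounded_block e k c = (\<lambda>a. if a < blen k then round_small e (seq (c * blen k + a)) else 0)"

text \<open>After rounding only symbols of modulus \<open>1 / m\<close> with
  \<open>m \<le> N\<close> can survive. Before the cut-off \<open>t\<close> of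
  \<open>seq_block_shape\<close> each \<open>m\<close> occurs at most once, since the level drops
  after a nonzero symbol; from \<open>t\<close> on the block is the initial one. So a number of
  codes polynomial in \<open>blen k\<close> suffices.\<close>

lemma rounded_block_card:
  assumes "1 / real (Suc N) \<le> e"
  shows "finite (range (rounded_block e k))" "card (range (rounded_block e k)) \<le> (blen k + 1) * (3 * blen k) ^ N"
proof -
  \<comment> \<open>A code is the cut-off together with, for each \<open>m\<close>, a position and a
    sign; sign 0 means that \<open>m\<close> does not occur.\<close>
  define G where "G = {..blen k} \<times> PiE {1..N} (\<lambda>_. {..<blen k} \<times> {-1, 0, 1::real})"
  define dec where "dec = (\<lambda>(t, g) a. if a < blen k then round_small e (if a < t
      then (\<Sum>m\<in>{1..N}. if fst (g m) = a then snd (g m) / real m else 0) else seq a) else 0)"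
  have *: "card ({..<blen k} \<times> {-1, 0, 1::real}) = 3 * blen k" by (simp add: card_cartesian_product)
  have G: "card G = (blen k + 1) * (3 * blen k) ^ N" "finite G"
    unfolding G_def card_cartesian_product[of "{..blen k}"] card_PiE[OF finite_atLeastAtMost] *
    by (simp_all add: finite_PiE)
  have "rounded_block e k c \<in> dec ` G" for c
  proof -
    let ?v = "\<lambda>a. seq (c * blen k + a)" and ?l = "\<lambda>a. level (c * blen k + a)"
    obtain t where t: "t \<le> blen k" "\<And>a. t \<le> a \<Longrightarrow> a < blen k \<Longrightarrow> ?v a = seq a"
      "\<And>a b. a < b \<Longrightarrow> b < t \<Longrightarrow> ?v a \<noteq> 0 \<Longrightarrow> ?l b < ?l a"
      using seq_block_shape[of k c] by blast
    define Q where "Q = (\<lambda>m a. a < t \<and> ?v a \<noteq> 0 \<and> ?l a = m)"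
    have Q_unique: "a = b" if "Q m a" "Q m b" for m a b
      using t(3)[of a b] t(3)[of b a] that unfolding Q_def by (metis less_irrefl linorder_neqE_nat)
    define g where "g = (\<lambda>m\<in>{1..N}. if \<exists>a. Q m a
        then (THE a. Q m a, real m * ?v (THE a. Q m a)) else (0, 0))"
    have g: "g m = (a, real m * ?v a)" if "Q m a" "m \<in> {1..N}" for m a
    proof -
      have "(THE a. Q m a) = a" using that Q_unique by blast
      then show ?thesis using that by (auto simp: g_def)
    qed
    have g0: "g m = (0, 0)" if "\<not> (\<exists>a. Q m a)" "m \<in> {1..N}" for m
      unfolding g_def using that by (simp only: restrict_apply' if_False)
    have "g m \<in> {..<blen k} \<times> {-1, 0, 1}" if m: "m \<in> {1..N}" for m
    proof (cases "\<exists>a. Q m a")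
      case True
      then obtain a where a: "Q m a" by blast
      then have "\<bar>?v a\<bar> = 1 / real m" "a < blen k"
        using seq_cases[of "c * blen k + a"] t(1) by (auto simp: Q_def)
      then have "\<bar>real m * ?v a\<bar> = 1" using m by (simp add: abs_mult)
      then have "real m * ?v a = 1 \<or> real m * ?v a = -1" by linarith
      then show ?thesis using g[OF a m] \<open>a < blen k\<close> by auto
    qed (simp add: g0[OF _ m])
    moreover have "g \<in> extensional {1..N}" by (simp add: g_def)
    ultimately have "(t, g) \<in> G" using t(1) unfolding G_def by (simp add: PiE_iff)
    moreover have "rounded_block e k c = dec (t, g)"
    proof
      fix a
      show "rounded_block e k c a = dec (t, g) a"
      proof (cases "a < t")
        case True
        have summand: "(if fst (g m) = a then snd (g m) / real m else 0) = (if Q m a then ?v a else 0)"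
          if m: "m \<in> {1..N}" for m
        proof (cases "\<exists>b. Q m b")
          case True
          then obtain b where b: "Q m b" by blast
          then have "Q m a \<longleftrightarrow> a = b" using Q_unique[OF b] b by metis
          then show ?thesis using g[OF b m] m by simp
        qed (simp add: g0[OF _ m])
        have "round_small e (\<Sum>m\<in>{1..N}. if fst (g m) = a then snd (g m) / real m else 0) = round_small e (?v a)"
        proof (cases "?v a \<noteq> 0 \<and> ?l a \<le> N")
          case v: True
          then have "?l a \<in> {1..N}" using seq_cases[of "c * blen k + a"] by auto
          moreover have "Q m a \<longleftrightarrow> m = ?l a" for m using v \<open>a < t\<close> by (auto simp: Q_def)
          ultimately show ?thesis using summand by simp
        next
          case v: False
          \<comment> \<open>Either the symbol is 0 or its level exceeds \<open>N\<close>, so that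
            its modulus is at most \<open>1 / Suc N \<le> e\<close>; no \<open>m\<close> in
            \<open>{1..N}\<close> codes it.\<close>
          have "round_small e (?v a) = 0"
          proof (cases "?v a = 0")
            case False
            then have "\<bar>?v a\<bar> = 1 / real (?l a)" "?l a \<ge> Suc N"
              using seq_cases[of "c * blen k + a"] v by auto
            moreover from this have "1 / real (?l a) \<le> 1 / real (Suc N)"
              by (intro divide_left_mono) auto
            ultimately show ?thesis using assms by (simp add: round_small_def)
          qed (simp add: round_small_def)
          moreover have "\<not> Q m a" if "m \<in> {1..N}" for m using v that by (auto simp: Q_def)
          then have "(\<Sum>m\<in>{1..N}. if fst (g m) = a then snd (g m) / real m else 0) = 0"
            using summand by (intro sum.neutral) simp
          ultimately show ?thesis by (simp add: round_small_def)
        qed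
        then show ?thesis using True t(1) by (simp add: rounded_block_def dec_def)
      next
        case False
        then show ?thesis using t(2)[of a] by (simp add: rounded_block_def dec_def)
      qed
    qed
    ultimately show ?thesis by blast
  qed
  then have sub: "range (rounded_block e k) \<subseteq> dec ` G" by blast
  show "finite (range (rounded_block e k))" using sub G(2) by (meson finite_imageI finite_subset)
  have "card (range (rounded_block e k)) \<le> card (dec ` G)" using sub G(2) by (intro card_mono) auto
  also have "\<dots> \<le> card G" using G(2) by (rule card_image_le)
  finally show "card (range (rounded_block e k)) \<le> (blen k + 1) * (3 * blen k) ^ N" using G(1) by simp
qed

lemma tail_from_approx:
  assumes "x \<in> shift_space" "e > 0"
  shows "\<exists>p. \<forall>i<n. \<bar>seq (p + i) - x i\<bar> < e"
  using assms shift_space_iff by blast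

text \<open>\<open>N\<close> and \<open>J\<close> depend on \<open>\<epsilon>\<close> alone, so
  \<open>k\<close> stays free: the exponent is about \<open>n / blen k\<close> while the base is
  polynomial in \<open>blen k\<close>. One tail is kept for each combination of offset and rounded
  blocks; the extra \<open>J\<close> coordinates control the distance up to time
  \<open>n\<close>.\<close>

lemma spanning_set_bound:
  assumes "\<epsilon> > 0"
  shows "\<exists>N J. \<forall>n k. \<exists>E. finite E \<and> E \<noteq> {} \<and> spanning_set shift_space shift n \<epsilon> E \<and>
    card E \<le> blen k * ((blen k + 1) * (3 * blen k) ^ N) ^ ((n + J) div blen k + 2)"
proof -
  obtain J \<delta> where \<delta>: "\<delta> > 0"
    "\<And>x y :: nat \<Rightarrow> real. (\<forall>i<J. \<bar>x i - y i\<bar> \<le> \<delta>) \<Longrightarrow> dist x y \<le> \<epsilon>"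
    using dist_window[OF assms] by blast
  \<comment> \<open>Equal roundings differ by at most \<open>2 * e = \<delta> / 2\<close>; the other
    half of \<open>\<delta>\<close> goes to the approximation of \<open>x\<close> by the
    sequence.\<close>
  define e where "e = \<delta> / 4"
  have "e > 0" using \<delta> by (simp add: e_def)
  then obtain N where N: "1 / real (Suc N) < e" using nat_approx_posE[of e] by blast
  have "\<exists>E. finite E \<and> E \<noteq> {} \<and> spanning_set shift_space shift n \<epsilon> E \<and>
    card E \<le> blen k * ((blen k + 1) * (3 * blen k) ^ N) ^ ((n + J) div blen k + 2)" for n k
  proof -
    \<comment> \<open>A window of length \<open>n + J\<close> with any offset inside a block meets
      at most this many blocks.\<close>
    define M where "M = (n + J) div blen k + 2"
    \<comment> \<open>A window is determined, up to rounding, by its offset and by the blocks it meets.\<close>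
    define key where "key = (\<lambda>p. (p mod blen k, \<lambda>j\<in>{..<M}. rounded_block e k (p div blen k + j)))"
    have key_eq: "round_small e (seq (p + i)) = round_small e (seq (p' + i))"
      if "key p = key p'" "i < n + J" for p p' i
    proof -
      define r where "r = p mod blen k"
      have r: "r < blen k" "p' mod blen k = r" using that by (auto simp: r_def key_def)
      define j a where "j = (r + i) div blen k" and "a = (r + i) mod blen k"
      have "r + i < blen k + (n + J)" using r that by simp
      then have "j \<le> (blen k + (n + J)) div blen k" unfolding j_def by (intro div_le_mono) auto
      then have "j < M" by (simp add: M_def)
      then have *: "snd (key s) j = rounded_block e k (s div blen k + j)" for s by (simp add: key_def)
      have "rounded_block e k (p div blen k + j) = rounded_block e k (p' div blen k + j)"
        using that(1) * by metis
      moreover have split: "s + i = (s div blen k + j) * blen k + a" if "s mod blen k = r" for s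
      proof -
        have "s + i = s div blen k * blen k + (r + i)" using that by (metis add.assoc div_mult_mod_eq)
        also have "r + i = j * blen k + a" by (simp add: j_def a_def)
        finally show ?thesis by (simp add: algebra_simps)
      qed
      moreover have "a < blen k" by (simp add: a_def)
      ultimately show ?thesis using split[of p] split[of p'] r
        unfolding rounded_block_def by (metis r_def)
    qed
    have fin: "finite (range (rounded_block e k))" and card: "card (range (rounded_block e k)) \<le> (blen k + 1) * (3 * blen k) ^ N"
      using rounded_block_card[of N e k] N by auto
    let ?K = "{..<blen k} \<times> PiE {..<M} (\<lambda>_. range (rounded_block e k))"
    have sub: "range key \<subseteq> ?K" by (auto simp: key_def)
    have finK: "finite ?K" using fin by (auto intro: finite_PiE)
    have "card (range key) \<le> card ?K" by (rule card_mono[OF finK sub])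
    also have "\<dots> = blen k * card (range (rounded_block e k)) ^ M"
      by (simp add: card_cartesian_product card_PiE)
    also have "\<dots> \<le> blen k * ((blen k + 1) * (3 * blen k) ^ N) ^ M"
      using card by (intro mult_left_mono power_mono) auto
    finally have cardkey: "card (range key) \<le> blen k * ((blen k + 1) * (3 * blen k) ^ N) ^ M" .
    have finkey: "finite (range key)" using finK sub by (rule finite_subset[rotated])
    define rep where "rep w = (SOME p. key p = w)" for w
    have rep: "key (rep (key p)) = key p" for p unfolding rep_def by (rule someI) simp
    define E where "E = (\<lambda>w. tail_from (rep w)) ` range key"
    have "spanning_set shift_space shift n \<epsilon> E" unfolding spanning_set_def
    proof (intro conjI ballI)
      show "E \<subseteq> shift_space" using tail_from_in_shift_space by (auto simp: E_def)
      fix x assume "x \<in> shift_space"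
      then obtain p where p: "\<And>i. i < n + J \<Longrightarrow> \<bar>seq (p + i) - x i\<bar> < \<delta> / 2"
        using tail_from_approx[of x "\<delta>/2" "n + J"] \<delta> by auto
      define p' where "p' = rep (key p)"
      have "\<bar>x i - seq (p' + i)\<bar> \<le> \<delta>" if "i < n + J" for i
      proof -
        have "\<bar>seq (p + i) - seq (p' + i)\<bar> \<le> 2 * e"
          using \<open>e > 0\<close> by (intro round_small_eqD key_eq[OF _ that]) (auto simp: rep p'_def)
        then show ?thesis using p[OF that] unfolding e_def by linarith
      qed
      then have "\<forall>i<n. dist ((shift ^^ i) x) ((shift ^^ i) (tail_from p')) \<le> \<epsilon>"
        by (auto intro!: \<delta>(2) simp: funpow_shift tail_from_def)
      then show "\<exists>y\<in>E. \<forall>i<n. dist ((shift ^^ i) x) ((shift ^^ i) y) \<le> \<epsilon>"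
        by (intro bexI[of _ "tail_from p'"]) (auto simp: E_def p'_def)
    qed
    moreover have "finite E" "E \<noteq> {}" using finkey by (auto simp: E_def)
    moreover have "card E \<le> blen k * ((blen k + 1) * (3 * blen k) ^ N) ^ M"
      unfolding E_def using card_image_le[OF finkey] cardkey by (rule le_trans)
    ultimately show ?thesis unfolding M_def by blast
  qed
  then show ?thesis by blast
qed

lemma filterlim_blen: "filterlim (\<lambda>k. real (blen k)) at_top sequentially"
proof (rule filterlim_at_top_mono[OF filterlim_real_sequentially])
  show "\<forall>\<^sub>F k in sequentially. real k \<le> real (blen k)"
    by (rule always_eventually) (auto simp: less_blen less_imp_le)
qed

text \<open>For fixed \<open>k\<close>, letting \<open>n\<close> grow leaves
  \<open>L k / blen k\<close>; then \<open>k\<close> grows, and \<open>L k\<close> is only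
  logarithmic in \<open>blen k\<close>.\<close>

lemma limsup_spanning_le_0:
  assumes "\<epsilon> > 0"
  shows "limsup (\<lambda>n. INF E\<in>{E. finite E \<and> spanning_set shift_space shift n \<epsilon> E}.
           ereal (ln (real (card E)) / real n)) \<le> 0" (is "limsup ?f \<le> 0")
proof -
  obtain N J where NJ: "\<And>n k. \<exists>E. finite E \<and> E \<noteq> {} \<and> spanning_set shift_space shift n \<epsilon> E \<and>
    card E \<le> blen k * ((blen k + 1) * (3 * blen k) ^ N) ^ ((n + J) div blen k + 2)"
    using spanning_set_bound[OF assms] by blast
  define L where "L = (\<lambda>k. ln (real (blen k) + 1) + real N * ln (3 * real (blen k)))"
  have "limsup ?f \<le> ereal (L k / real (blen k))" for k
  proof -
    define B where "B = (blen k + 1) * (3 * blen k) ^ N"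
    have B: "real B \<ge> 1" "ln (real B) = L k"
    proof -
      have "B > 0" by (simp add: B_def)
      then show "real B \<ge> 1" by linarith
      show "ln (real B) = L k" using ln_realpow[of "3 * real (blen k)" N]
        unfolding B_def L_def of_nat_mult of_nat_power
        by (subst ln_mult) (auto simp: add.commute)
    qed
    define C where "C = ln (real (blen k)) + (real J / real (blen k) + 2) * L k"
    have "?f n \<le> ereal (C / real n + L k / real (blen k))" if n: "n > 0" for n
    proof -
      obtain E where E: "finite E" "E \<noteq> {}" "spanning_set shift_space shift n \<epsilon> E"
        "card E \<le> blen k * B ^ ((n + J) div blen k + 2)" using NJ B_def by blast
      have "real (card E) \<le> real (blen k) * real B ^ ((n + J) div blen k + 2)"
        using of_nat_mono[OF E(4), where ?'a = real] by simp
      moreover have "card E > 0" using E by (simp add: card_gt_0_iff)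
      ultimately have "ln (real (card E)) \<le> ln (real (blen k) * real B ^ ((n + J) div blen k + 2))"
        by (intro ln_mono) auto
      also have "\<dots> = ln (real (blen k)) + real ((n + J) div blen k + 2) * L k"
        using B by (subst ln_mult) (auto simp: ln_realpow simp del: power_Suc)
      also have "\<dots> \<le> ln (real (blen k)) + ((real n + real J) / real (blen k) + 2) * L k"
      proof -
        have "real ((n + J) div blen k) \<le> real (n + J) / real (blen k)" by (rule of_nat_div_le_of_nat)
        moreover have "0 \<le> L k" using B by (metis ln_ge_zero)
        ultimately show ?thesis by (intro add_left_mono mult_right_mono) auto
      qed
      also have "\<dots> = C + real n * (L k / real (blen k))"
        by (simp add: C_def field_simps)
      finally have "ln (real (card E)) / real n \<le> C / real n + L k / real (blen k)"
        using n by (simp add: field_simps)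
      moreover have "?f n \<le> ereal (ln (real (card E)) / real n)"
        using E by (intro INF_lower) auto
      ultimately show ?thesis by (meson ereal_less_eq(3) order_trans)
    qed
    then have "limsup ?f \<le> limsup (\<lambda>n. ereal (C / real n + L k / real (blen k)))"
      by (intro Limsup_mono) (auto simp: eventually_sequentially intro!: exI[of _ 1])
    also have "\<dots> = ereal (L k / real (blen k))"
    proof (rule lim_imp_Limsup)
      have "(\<lambda>n. C / real n + L k / real (blen k)) \<longlonglongrightarrow> 0 + L k / real (blen k)"
        by (intro tendsto_add tendsto_const lim_const_over_n)
      then show "(\<lambda>n. ereal (C / real n + L k / real (blen k))) \<longlonglongrightarrow> ereal (L k / real (blen k))"
        by (simp add: tendsto_ereal)
    qed simp
    finally show ?thesis .
  qed
  moreover have "(\<lambda>k. ereal (L k / real (blen k))) \<longlonglongrightarrow> ereal 0"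
  proof (rule tendsto_ereal)
    have "((\<lambda>x::real. (ln (x + 1) + real N * ln (3 * x)) / x) \<longlongrightarrow> 0) at_top"
      by real_asymp
    from filterlim_compose[OF this filterlim_blen]
    show "(\<lambda>k. L k / real (blen k)) \<longlonglongrightarrow> 0" unfolding L_def .
  qed
  ultimately have "limsup ?f \<le> ereal 0"
    by (intro LIMSEQ_le_const[of "\<lambda>k. ereal (L k / real (blen k))"]) auto
  then show ?thesis by (simp add: zero_ereal_def)
qed

lemma shift_space_entropy: "topological_entropy shift_space shift = 0"
proof (rule antisym)
  show "topological_entropy shift_space shift \<le> 0"
    unfolding topological_entropy_def using limsup_spanning_le_0 by (intro SUP_least) auto
  let ?f = "\<lambda>\<epsilon> n. INF E\<in>{E. finite E \<and> spanning_set shift_space shift n \<epsilon> E}. ereal (ln (real (card E)) / real n)"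
  \<comment> \<open>Entropy is a supremum over scales, so scale 1 is enough. Spanning sets are
    nonempty, and at \<open>n = 0\<close> the quotient has the value 0.\<close>
  have "0 \<le> ?f 1 n" for n
  proof (rule INF_greatest)
    fix E assume E: "E \<in> {E. finite E \<and> spanning_set shift_space shift n 1 E}"
    then have "E \<noteq> {}" using tail_from_in_shift_space unfolding spanning_set_def by blast
    then have "card E \<ge> 1" using E by (simp add: Suc_leI card_gt_0_iff)
    then have "0 \<le> ln (real (card E)) / real n" by (intro divide_nonneg_nonneg ln_ge_zero) auto
    then show "0 \<le> ereal (ln (real (card E)) / real n)" by simp
  qed
  then have "0 \<le> limsup (?f 1)" by (intro le_Limsup) auto
  also have "\<dots> \<le> topological_entropy shift_space shift"
    unfolding topological_entropy_def by (rule SUP_upper) simp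
  finally show "0 \<le> topological_entropy shift_space shift" .
qed

section \<open>The odometer\<close>

text \<open>
  The odometer as the inverse limit of the cyclic groups of order \<open>blen k\<close>: a point is a compatible
  family of residues.
\<close>

definition residue_space :: "(nat \<Rightarrow> nat) set" where
  "residue_space = {r. \<forall>k. r (Suc k) mod blen k = r k}"

definition cyl :: "nat \<Rightarrow> nat \<Rightarrow> (nat \<Rightarrow> nat) set" where
  "cyl k a = {r \<in> residue_space. r k = a}"

definition cyls :: "(nat \<Rightarrow> nat) set set" where
  "cyls = {cyl k a | k a. True}"

lemma residue_space_less: "r \<in> residue_space \<Longrightarrow> r k < blen k"
  unfolding residue_space_def by (metis (mono_tags, lifting) mem_Collect_eq mod_less_divisor blen_pos)

lemma residue_space_mod: assumes "r \<in> residue_space" "k \<le> j" shows "r j mod blen k = r k"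
  using assms(2)
proof (induction j rule: dec_induct)
  case base
  show ?case using residue_space_less[OF assms(1), of k] by simp
next
  case (step n)
  have "r (Suc n) mod blen n = r n" using assms(1) by (simp add: residue_space_def)
  then show ?case using step blen_dvd[of k n] by (metis mod_mod_cancel)
qed

lemma residue_space_Suc: "r \<in> residue_space \<Longrightarrow> r (Suc k) = (r (Suc k) div blen k) * blen k + r k"
  unfolding residue_space_def by (metis (mono_tags, lifting) div_mult_mod_eq mem_Collect_eq)

lemma cyl_empty: "blen k \<le> a \<Longrightarrow> cyl k a = {}"
  using residue_space_less[of _ k] by (auto simp: cyl_def not_less[symmetric])

lemma cyl_subset: "cyl k a \<subseteq> residue_space"
  by (auto simp: cyl_def)

lemma cyl_0: "cyl 0 0 = residue_space"
  using residue_space_less[of _ 0] by (auto simp: cyl_def)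

lemma cyl_in_cyls: "cyl k a \<in> cyls"
  by (auto simp: cyls_def)

lemma cyls_Pow: "cyls \<subseteq> Pow residue_space"
  using cyl_subset by (auto simp: cyls_def)

lemma cyl_Int: "k \<le> j \<Longrightarrow> cyl k a \<inter> cyl j b = (if b mod blen k = a then cyl j b else {})"
  using residue_space_mod by (auto simp: cyl_def)

text \<open>Two cylinders are nested or disjoint, and the empty set is itself a cylinder, with a
  residue out of range.\<close>

lemma cyls_Int_stable: "Int_stable cyls"
proof (rule Int_stableI)
  have e: "{} \<in> cyls" using cyl_empty[of 0 1] cyl_in_cyls[of 0 1] by simp
  have *: "cyl k a \<inter> cyl j b \<in> cyls" if "k \<le> j" for k a j b
    using cyl_Int[OF that, of a b] e cyl_in_cyls by simp
  fix A B assume "A \<in> cyls" "B \<in> cyls"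
  then obtain k a j b where AB: "A = cyl k a" "B = cyl j b" by (auto simp: cyls_def)
  show "A \<inter> B \<in> cyls" unfolding AB using *[of k j a b] *[of j k b a] le_cases[of k j]
    by (metis Int_commute)
qed

section \<open>Mixed radix digits and the Haar measure of the odometer\<close>

definition digit_sum :: "(nat \<Rightarrow> nat) \<Rightarrow> nat \<Rightarrow> nat" where
  "digit_sum w k = (\<Sum>i<k. w i * blen i)"

lemma digit_sum_Suc: "digit_sum w (Suc k) = w k * blen k + digit_sum w k"
  by (simp add: digit_sum_def)

lemma digit_sum_less: assumes "\<And>i. w i < branching i" shows "digit_sum w k < blen k"
proof (induction k)
  case (Suc k)
  show ?case unfolding digit_sum_Suc using Suc assms by (rule block_less)
qed (simp add: digit_sum_def)

lemma digit_sum_in_residue_space: assumes "\<And>i. w i < branching i" shows "digit_sum w \<in> residue_space"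
  using digit_sum_less[OF assms] by (simp add: residue_space_def digit_sum_Suc)

text \<open>The residue modulo \<open>blen k\<close> and the first \<open>k\<close> digits determine
  each other, so a cylinder pulls back to a box, whose product measure is known.\<close>

lemma digit_sum_eq_iff:
  assumes "a < blen k"
  shows "\<exists>b. (\<forall>i<k. b i < branching i) \<and>
    (\<forall>w. (\<forall>i. w i < branching i) \<longrightarrow> (digit_sum w k = a \<longleftrightarrow> (\<forall>i<k. w i = b i)))"
  using assms
proof (induction k arbitrary: a)
  case 0
  then show ?case by (auto simp: digit_sum_def)
next
  case (Suc k)
  obtain c a' where a: "a = c * blen k + a'" "a' < blen k" "c < branching k"
    using block_decomp[OF Suc.prems] by metis
  obtain b where b: "\<forall>i<k. b i < branching i"
    "\<And>w. (\<forall>i. w i < branching i) \<Longrightarrow> (digit_sum w k = a' \<longleftrightarrow> (\<forall>i<k. w i = b i))"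
    using Suc.IH[OF a(2)] by blast
  have "digit_sum w (Suc k) = a \<longleftrightarrow> (\<forall>i<Suc k. w i = (b(k := c)) i)" if w: "\<forall>i. w i < branching i" for w
  proof -
    have lt: "digit_sum w k < blen k" using digit_sum_less w by blast
    have "digit_sum w (Suc k) = a \<longleftrightarrow> w k = c \<and> digit_sum w k = a'"
    proof
      assume "digit_sum w (Suc k) = a"
      then have eq: "w k * blen k + digit_sum w k = c * blen k + a'" by (simp add: digit_sum_Suc a)
      have "w k = (w k * blen k + digit_sum w k) div blen k" using lt by simp
      also have "\<dots> = c" unfolding eq using a by simp
      finally show "w k = c \<and> digit_sum w k = a'" using eq by simp
    qed (simp add: digit_sum_Suc a)
    then show ?thesis using b(2)[OF w] by (auto simp: less_Suc_eq)
  qed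
  moreover have "\<forall>i<Suc k. (b(k := c)) i < branching i" using b(1) a(3) by (simp add: less_Suc_eq)
  ultimately show ?case by blast
qed

text \<open>The Haar probability measure of the odometer, fixed by its values on cylinders, which
  are uniform in each cyclic quotient.\<close>

locale odometer = prob_space M for M :: "(nat \<Rightarrow> nat) measure" +
  assumes space_M: "space M = residue_space"
    and sets_M: "sets M = sigma_sets residue_space cyls"
    and cyl_measure: "a < blen k \<Longrightarrow> measure M (cyl k a) = 1 / real (blen k)"

text \<open>Independent uniform digits are summed up: the measure is the image of a product measure
  under \<open>digit_sum\<close>.\<close>

lemma odometer_exists: "\<exists>M. odometer M"
proof -
  define D where "D = (\<lambda>i. uniform_count_measure {..<branching i})"
  define P where "P = PiM UNIV D"
  have D: "prob_space (D i)" for i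
    unfolding D_def using branching_ge(2)[of i] by (intro prob_space_uniform_count_measure) (auto simp: lessThan_empty_iff)
  interpret D: product_prob_space D UNIV
    by (simp add: product_prob_space_def product_sigma_finite_def D prob_space_imp_sigma_finite
        product_prob_space_axioms_def)
  have space_D: "space (D i) = {..<branching i}" for i by (simp add: D_def space_uniform_count_measure)
  have w: "w i < branching i" if "w \<in> space P" for w i
    using that by (auto simp: P_def space_PiM PiE_def Pi_def space_D)
  have pre: "digit_sum -` cyl k a \<inter> space P \<in> sets P"
    "a < blen k \<Longrightarrow> emeasure P (digit_sum -` cyl k a \<inter> space P) = ennreal (1 / real (blen k))" for k a
  proof -
    have "digit_sum -` cyl k a \<inter> space P \<in> sets P \<and> (a < blen k \<longrightarrow>
      emeasure P (digit_sum -` cyl k a \<inter> space P) = ennreal (1 / real (blen k)))"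
    proof (cases "a < blen k")
      case True
      then obtain b where b: "\<forall>i<k. b i < branching i"
        "\<And>w. (\<forall>i. w i < branching i) \<Longrightarrow> (digit_sum w k = a \<longleftrightarrow> (\<forall>i<k. w i = b i))"
        using digit_sum_eq_iff[OF True] by blast
      have eq: "digit_sum -` cyl k a \<inter> space P = {w \<in> space P. \<forall>i\<in>{..<k}. w i \<in> {b i}}"
        using b(2) w digit_sum_in_residue_space by (auto simp: cyl_def)
      have sets: "{b i} \<in> sets (D i)" if "i \<in> {..<k}" for i
        using b(1) that by (simp add: D_def sets_uniform_count_measure)
      have "emeasure P {w \<in> space P. \<forall>i\<in>{..<k}. w i \<in> {b i}} = (\<Prod>i\<in>{..<k}. emeasure (D i) {b i})"
        unfolding P_def using sets by (intro D.emeasure_PiM_Collect) auto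
      also have "\<dots> = (\<Prod>i\<in>{..<k}. ennreal (1 / real (branching i)))"
        using b(1) by (intro prod.cong refl) (simp add: D_def emeasure_uniform_count_measure)
      also have "\<dots> = ennreal (\<Prod>i\<in>{..<k}. 1 / real (branching i))"
        by (rule prod_ennreal) simp
      also have "(\<Prod>i\<in>{..<k}. 1 / real (branching i)) = 1 / real (blen k)"
        by (induction k) simp_all
      finally have m: "emeasure P (digit_sum -` cyl k a \<inter> space P) = ennreal (1 / real (blen k))"
        unfolding eq .
      \<comment> \<open>A non-measurable set would have measure 0, so the value just computed also
        yields measurability.\<close>
      then have "emeasure P (digit_sum -` cyl k a \<inter> space P) \<noteq> 0" by simp
      then show ?thesis using m emeasure_notin_sets by blast
    qed (simp add: cyl_empty)
    then show "digit_sum -` cyl k a \<inter> space P \<in> sets P"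
      "a < blen k \<Longrightarrow> emeasure P (digit_sum -` cyl k a \<inter> space P) = ennreal (1 / real (blen k))" by auto
  qed
  define M where "M = distr P (sigma residue_space cyls) digit_sum"
  have meas: "digit_sum \<in> measurable P (sigma residue_space cyls)"
    by (rule measurable_measure_of) (use cyls_Pow w digit_sum_in_residue_space pre(1) in \<open>auto simp: cyls_def\<close>)
  have "odometer M"
  proof (intro odometer.intro odometer_axioms.intro)
    show "prob_space M" unfolding M_def using D.prob_space_axioms meas
      by (simp add: P_def prob_space.prob_space_distr)
    show "space M = residue_space" "sets M = sigma_sets residue_space cyls"
      using cyls_Pow by (simp_all add: M_def)
    show "measure M (cyl k a) = 1 / real (blen k)" if "a < blen k" for k a
    proof -
      have "cyl k a \<in> sets (sigma residue_space cyls)" using cyls_Pow cyl_in_cyls by auto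
      then show ?thesis unfolding M_def using meas pre(2)[OF that]
        by (simp add: measure_def emeasure_distr)
    qed
  qed
  then show ?thesis by blast
qed

section \<open>Adding one on the odometer\<close>

definition succ :: "(nat \<Rightarrow> nat) \<Rightarrow> nat \<Rightarrow> nat" where
  "succ r = (\<lambda>k. Suc (r k) mod blen k)"

lemma succ_in_residue_space: assumes "r \<in> residue_space" shows "succ r \<in> residue_space"
proof -
  have "Suc (r (Suc k)) mod blen (Suc k) mod blen k = Suc (r k) mod blen k" for k
  proof -
    have "Suc (r (Suc k)) mod blen (Suc k) mod blen k = Suc (r (Suc k)) mod blen k"
      by (rule mod_mod_cancel) simp
    also have "\<dots> = Suc (r (Suc k) mod blen k) mod blen k" by (simp add: mod_Suc_eq)
    also have "r (Suc k) mod blen k = r k" using assms by (simp add: residue_space_def)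
    finally show ?thesis by simp
  qed
  then show ?thesis by (simp add: residue_space_def succ_def)
qed

text \<open>Adding one permutes the residues modulo \<open>blen k\<close>, so cylinders pull back to
  cylinders of the same order.\<close>

lemma succ_vimage_cyl:
  assumes "a < blen k"
  shows "succ -` cyl k (Suc a mod blen k) \<inter> residue_space = cyl k a"
proof -
  have "Suc b mod blen k = Suc a mod blen k \<Longrightarrow> b = a" if "b < blen k" for b
    using that assms by (auto simp: mod_Suc split: if_splits)
  then show ?thesis using residue_space_less succ_in_residue_space by (fastforce simp: cyl_def succ_def)
qed

lemma mod_pred:
  assumes "b < blen k" obtains a where "a < blen k" "b = Suc a mod blen k"
proof (cases b)
  case 0
  then show ?thesis using that[of "blen k - 1"] by simp
next
  case (Suc a)
  then show ?thesis using that[of a] assms by simp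
qed

section \<open>The ergodic measure\<close>

text \<open>
  For a generic point \<open>r\<close> of the odometer the windows of \<open>seq\<close> at the positions \<open>r k\<close> stabilise; for
  other points \<open>lim\<close> may be a junk value.
\<close>

definition limit_seq :: "(nat \<Rightarrow> nat) \<Rightarrow> nat \<Rightarrow> real" where
  "limit_seq r n = lim (\<lambda>k. seq (r k + n))"

text \<open>The quotient \<open>r (Suc k) div blen k\<close> is the number of the copy of block
  \<open>k\<close> in which \<open>r\<close> lies. Eventually, windows must end before the block
  does and the modified copy 1 must be avoided.\<close>

definition generic :: "(nat \<Rightarrow> nat) \<Rightarrow> bool" where
  "generic r \<longleftrightarrow> (\<forall>n. \<forall>\<^sub>F k in sequentially. r k + n < blen k) \<and>
     (\<forall>\<^sub>F k in sequentially. r (Suc k) div blen k \<noteq> 1)"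

text \<open>Copies with a number other than 1 are unmodified, so a window that fits into block
  \<open>K\<close> is passed on unchanged to all later blocks.\<close>

lemma limit_seq_eq:
  assumes r: "r \<in> residue_space" and no1: "\<And>k. K \<le> k \<Longrightarrow> r (Suc k) div blen k \<noteq> 1"
    and n: "r K + n < blen K"
  shows "K \<le> k \<Longrightarrow> seq (r k + n) = seq (r K + n)" "limit_seq r n = seq (r K + n)"
proof -
  have *: "r k + n < blen k \<and> seq (r k + n) = seq (r K + n)" if "K \<le> k" for k
    using that
  proof (induction k rule: dec_induct)
    case (step k)
    define c where "c = r (Suc k) div blen k"
    have c: "c < branching k" using residue_space_less[OF r, of "Suc k"] by (simp add: c_def less_mult_imp_div_less)
    have s: "r (Suc k) + n = c * blen k + (r k + n)"
      using residue_space_Suc[OF r, of k] by (simp add: c_def)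
    have "c \<noteq> 1" using no1[OF step(1)] by (simp add: c_def)
    then show ?case unfolding s
      using step block_less[of "r k + n" k c] seq_block[of "r k + n" k c] c by simp
  qed (use n in simp)
  then show "K \<le> k \<Longrightarrow> seq (r k + n) = seq (r K + n)" by blast
  have "\<forall>\<^sub>F k in sequentially. seq (r k + n) = seq (r K + n)"
    using * unfolding eventually_sequentially by blast
  then show "limit_seq r n = seq (r K + n)"
    unfolding limit_seq_def by (intro limI tendsto_eventually)
qed

lemma eventually_limit_seq:
  assumes "r \<in> residue_space" "generic r"
  shows "\<forall>\<^sub>F k in sequentially. seq (r k + n) = limit_seq r n"
proof -
  obtain K where K: "\<And>k. K \<le> k \<Longrightarrow> r k + n < blen k" "\<And>k. K \<le> k \<Longrightarrow> r (Suc k) div blen k \<noteq> 1"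
    using assms(2) eventually_conj[of "\<lambda>k. r k + n < blen k" sequentially "\<lambda>k. r (Suc k) div blen k \<noteq> 1"]
    unfolding generic_def eventually_sequentially by blast
  have "limit_seq r n = seq (r K + n)"
    by (rule limit_seq_eq(2)[OF assms(1)]) (simp_all add: K del: One_nat_def)
  moreover have "seq (r k + n) = seq (r K + n)" if "K \<le> k" for k
  proof (rule limit_seq_eq(1)[OF assms(1)])
    show "r (Suc j) div blen j \<noteq> 1" if "K \<le> j" for j using K(2)[OF that] .
  qed (use K(1)[of K] that in auto)
  ultimately have "seq (r k + n) = limit_seq r n" if "K \<le> k" for k
    using that by metis
  then show ?thesis unfolding eventually_sequentially by blast
qed

lemma limit_seq_in_shift_space:
  assumes "r \<in> residue_space" "generic r"
  shows "limit_seq r \<in> shift_space"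
  unfolding shift_space_iff
proof (intro allI impI)
  fix n and e :: real assume "e > 0"
  have "\<forall>\<^sub>F k in sequentially. \<forall>i\<in>{..<n}. seq (r k + i) = limit_seq r i"
    by (intro eventually_ball_finite ballI eventually_limit_seq assms) simp
  then obtain k where "\<forall>i\<in>{..<n}. seq (r k + i) = limit_seq r i"
    using eventually_happens by fastforce
  then show "\<exists>p. \<forall>i<n. \<bar>seq (p + i) - limit_seq r i\<bar> < e"
    using \<open>e > 0\<close> by (intro exI[of _ "r k"]) simp
qed

lemma limit_seq_succ:
  assumes "r \<in> residue_space" "generic r"
  shows "limit_seq (succ r) = shift (limit_seq r)"
proof
  fix n
  \<comment> \<open>With room for one more position, \<open>succ\<close> adds one without wrapping
    around.\<close>
  have "\<forall>\<^sub>F k in sequentially. r k + 1 < blen k" using assms(2) unfolding generic_def by blast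
  then have "\<forall>\<^sub>F k in sequentially. seq (succ r k + n) = shift (limit_seq r) n"
    using eventually_limit_seq[OF assms, of "Suc n"]
    by eventually_elim (simp add: succ_def shift_def)
  then show "limit_seq (succ r) n = shift (limit_seq r) n"
    unfolding limit_seq_def by (intro limI tendsto_eventually)
qed

text \<open>The default \<open>tail_from 0\<close> lies in \<open>shift_space\<close>, so the map
  takes values there also at non-generic points.\<close>

definition factor_map :: "(nat \<Rightarrow> nat) \<Rightarrow> nat \<Rightarrow> real" where
  "factor_map r = (if limit_seq r \<in> shift_space then limit_seq r else tail_from 0)"

lemma factor_map_in_shift_space: "factor_map r \<in> shift_space"
  by (simp add: factor_map_def tail_from_in_shift_space)

lemma factor_map_succ:
  assumes "r \<in> residue_space" "generic r"
  shows "factor_map (succ r) = shift (factor_map r)"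
  using assms by (simp add: factor_map_def limit_seq_succ limit_seq_in_shift_space shift_in_shift_space)

section \<open>Haar measure: invariance under \<open>succ\<close> and almost sure genericity\<close>

context odometer
begin

lemma cyl_sets [measurable]: "cyl k a \<in> sets M"
  unfolding sets_M by (rule sigma_sets.Basic[OF cyl_in_cyls])

lemma measurable_coord [measurable]: "(\<lambda>r. r k) \<in> measurable M (count_space UNIV)"
proof -
  have "(\<lambda>r. r k) -` {a} \<inter> space M = cyl k a" for a by (auto simp: cyl_def space_M)
  then show ?thesis using cyl_sets
    by (subst measurable_count_space_eq_countable) auto
qed

lemma measurable_succ [measurable]: "succ \<in> measurable M M"
proof (rule measurable_sigma_sets[OF sets_M cyls_Pow])
  show "succ \<in> space M \<rightarrow> residue_space" using succ_in_residue_space by (simp add: space_M)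
  fix C assume "C \<in> cyls"
  then obtain k b where C: "C = cyl k b" by (auto simp: cyls_def)
  show "succ -` C \<inter> space M \<in> sets M"
  proof (cases "b < blen k")
    case True
    then obtain a where "a < blen k" "b = Suc a mod blen k" using mod_pred by metis
    then show ?thesis using succ_vimage_cyl[of a k] by (simp add: C space_M)
  qed (simp add: C cyl_empty)
qed

lemma emeasure_cyl: "a < blen k \<Longrightarrow> emeasure M (cyl k a) = ennreal (1 / real (blen k))"
  by (simp add: emeasure_eq_measure cyl_measure)

text \<open>\<open>succ\<close> preserves the measure of cylinders, which form an
  intersection-stable generator.\<close>

lemma distr_succ: "distr M M succ = M"
proof (rule measure_eqI_generator_eq[OF cyls_Int_stable cyls_Pow])
  fix C assume "C \<in> cyls"
  then obtain k b where C: "C = cyl k b" by (auto simp: cyls_def)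
  show "emeasure (distr M M succ) C = emeasure M C"
  proof (cases "b < blen k")
    case True
    then obtain a where a: "a < blen k" "b = Suc a mod blen k" using mod_pred by metis
    have "emeasure (distr M M succ) C = emeasure M (cyl k a)"
      using succ_vimage_cyl[OF a(1)] a by (simp add: C emeasure_distr space_M)
    then show ?thesis using a True by (simp add: C emeasure_cyl)
  qed (simp add: C cyl_empty)
next
  show "range (\<lambda>_. residue_space) \<subseteq> cyls" using cyl_in_cyls[of 0 0] by (auto simp: cyl_0)
  show "emeasure (distr M M succ) residue_space \<noteq> \<infinity>"
    using prob_space.emeasure_space_1[OF prob_space_distr[OF measurable_succ]]
    by (simp add: space_M)
qed (auto simp: sets_M)

lemma digit_1_sets [measurable]: "{r \<in> residue_space. r (Suc k) div blen k = 1} \<in> sets M"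
proof -
  have "{r \<in> space M. r (Suc k) div blen k = 1} \<in> sets M" by measurable
  then show ?thesis by (simp add: space_M)
qed

text \<open>The bound is the product of the two probabilities: fixing the residue modulo
  \<open>blen K\<close> and digit 1 at \<open>k\<close> leaves \<open>blen k / blen K\<close>
  residues modulo \<open>blen (Suc k)\<close>.\<close>

lemma prob_digit_1:
  assumes "p < blen K" "K \<le> k"
  shows "prob (cyl K p \<inter> {r \<in> residue_space. r (Suc k) div blen k = 1}) \<le> 1 / (real (blen K) * real (branching k))"
proof -
  obtain u where u: "blen k = blen K * u" using blen_dvd[OF assms(2)] by (auto elim: dvdE)
  have "u > 0" using u blen_pos[of k] by (cases u) auto
  have "cyl K p \<inter> {r \<in> residue_space. r (Suc k) div blen k = 1} \<subseteq> (\<Union>c<u. cyl (Suc k) (blen k + (c * blen K + p)))"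
  proof
    fix r assume r: "r \<in> cyl K p \<inter> {r \<in> residue_space. r (Suc k) div blen k = 1}"
    then have "r \<in> residue_space" "r K = p" by (auto simp: cyl_def)
    define c where "c = r k div blen K"
    have "r k = c * blen K + r K"
      using residue_space_mod[OF \<open>r \<in> residue_space\<close> assms(2)] div_mult_mod_eq[of "r k" "blen K"] by (simp add: c_def)
    moreover have "c < u" using residue_space_less[OF \<open>r \<in> residue_space\<close>, of k] u
      by (simp add: c_def less_mult_imp_div_less mult.commute)
    ultimately show "r \<in> (\<Union>c<u. cyl (Suc k) (blen k + (c * blen K + p)))"
      using r residue_space_Suc[OF \<open>r \<in> residue_space\<close>, of k] \<open>r K = p\<close> by (auto simp: cyl_def)
  qed
  then have "prob (cyl K p \<inter> {r \<in> residue_space. r (Suc k) div blen k = 1})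
      \<le> prob (\<Union>c<u. cyl (Suc k) (blen k + (c * blen K + p)))"
    by (intro finite_measure_mono) auto
  also have "\<dots> \<le> (\<Sum>c<u. prob (cyl (Suc k) (blen k + (c * blen K + p))))"
    by (intro finite_measure_subadditive_finite) auto
  also have "\<dots> \<le> (\<Sum>c<u. 1 / real (blen (Suc k)))"
  proof (rule sum_mono)
    fix c
    show "prob (cyl (Suc k) (blen k + (c * blen K + p))) \<le> 1 / real (blen (Suc k))"
      by (cases "blen k + (c * blen K + p) < blen (Suc k)") (simp_all add: cyl_measure cyl_empty del: blen.simps)
  qed
  also have "\<dots> = 1 / (real (blen K) * real (branching k))"
    using u \<open>u > 0\<close> by (simp add: field_simps)
  finally show ?thesis .
qed

text \<open>Borel-Cantelli twice: \<open>r k + n\<close> lies beyond block \<open>k\<close> with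
  probability at most \<open>n / blen k\<close>, and copy 1 is entered with probability at most
  \<open>1 / branching k\<close>; both are summable.\<close>

lemma AE_generic: "AE r in M. generic r"
proof -
  have "AE r in M. \<forall>\<^sub>F k in sequentially. r k + n < blen k" for n
  proof -
    have sets: "{r \<in> space M. blen k \<le> r k + n} \<in> sets M" for k by measurable
    have prob_le: "prob {r \<in> space M. blen k \<le> r k + n} \<le> real n * (1/2) ^ k" for k
    proof -
      have "{r \<in> space M. blen k \<le> r k + n} \<subseteq> (\<Union>a\<in>{blen k - n..<blen k}. cyl k a)"
        using residue_space_less[of _ k] by (auto simp: cyl_def space_M)
      then have "prob {r \<in> space M. blen k \<le> r k + n} \<le> prob (\<Union>a\<in>{blen k - n..<blen k}. cyl k a)"
        by (intro finite_measure_mono) auto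
      also have "\<dots> \<le> (\<Sum>a\<in>{blen k - n..<blen k}. prob (cyl k a))"
        by (intro finite_measure_subadditive_finite) auto
      also have "\<dots> = (\<Sum>a\<in>{blen k - n..<blen k}. 1 / real (blen k))"
        by (intro sum.cong) (auto simp: cyl_measure)
      also have "\<dots> \<le> real n * (1 / real (blen k))"
        by (simp add: divide_right_mono)
      also have "\<dots> \<le> real n * (1/2) ^ k"
      proof (intro mult_left_mono)
        have "real (2 ^ k) \<le> real (blen k)" using blen_ge_power[of k] by (rule of_nat_mono)
        then have "1 / real (blen k) \<le> 1 / 2 ^ k" by (intro divide_left_mono) auto
        then show "1 / real (blen k) \<le> (1/2) ^ k" by (simp add: power_one_over)
      qed simp
      finally show ?thesis .
    qed
    have "summable (\<lambda>k. prob {r \<in> space M. blen k \<le> r k + n})"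
      by (rule summable_comparison_test'[of "\<lambda>k. real n * (1/2) ^ k"])
        (use prob_le in \<open>auto intro!: summable_mult summable_geometric\<close>)
    then have "AE r in M. \<forall>\<^sub>F k in sequentially. r \<in> space M - {r \<in> space M. blen k \<le> r k + n}"
      using sets by (intro borel_cantelli_AE1) (auto simp: emeasure_eq_measure)
    then show ?thesis by eventually_elim (auto elim: eventually_mono)
  qed
  moreover have "AE r in M. \<forall>\<^sub>F k in sequentially. r (Suc k) div blen k \<noteq> 1"
  proof -
    have prob_le: "prob {r \<in> residue_space. r (Suc k) div blen k = 1} \<le> (1/2) ^ k" for k
    proof -
      have "{r \<in> residue_space. r (Suc k) div blen k = 1} = cyl 0 0 \<inter> {r \<in> residue_space. r (Suc k) div blen k = 1}"
        by (auto simp: cyl_0)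
      then have "prob {r \<in> residue_space. r (Suc k) div blen k = 1} \<le> 1 / real (branching k)"
        using prob_digit_1[of 0 0 k] by simp
      also have "\<dots> \<le> (1/2) ^ k" by (simp add: branching_def power_one_over field_simps)
      finally show ?thesis .
    qed
    have "summable (\<lambda>k. prob {r \<in> residue_space. r (Suc k) div blen k = 1})"
      by (rule summable_comparison_test'[of "\<lambda>k. (1/2) ^ k"])
        (use prob_le in \<open>auto intro!: summable_geometric\<close>)
    then have "AE r in M. \<forall>\<^sub>F k in sequentially. r \<in> space M - {r \<in> residue_space. r (Suc k) div blen k = 1}"
      by (intro borel_cantelli_AE1 digit_1_sets) (auto simp: emeasure_eq_measure)
    then show ?thesis by eventually_elim (auto elim: eventually_mono simp: space_M)
  qed
  ultimately show ?thesis unfolding generic_def by (simp add: AE_all_countable)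
qed

lemma measurable_limit_seq [measurable]: "limit_seq \<in> borel_measurable M"
proof (rule measurable_coordinatewise_then_product)
  fix n show "(\<lambda>r. limit_seq r n) \<in> borel_measurable M"
    unfolding limit_seq_def by measurable
qed

lemma measurable_factor_map [measurable]: "factor_map \<in> measurable M (restrict_space borel shift_space)"
proof (rule measurable_restrict_space2)
  have [measurable]: "shift_space \<in> sets borel" using shift_space_closed by (rule borel_closed)
  show "factor_map \<in> borel_measurable M" unfolding factor_map_def by measurable
qed (simp add: factor_map_in_shift_space)

section \<open>The image measure: invariance, ergodicity and full support\<close>

definition mu :: "(nat \<Rightarrow> real) measure" where
  "mu = distr M (restrict_space borel shift_space) factor_map"

lemma space_mu: "space mu = shift_space"
  by (simp add: mu_def space_restrict_space)

lemma sets_mu: "sets mu = sets (restrict_space borel shift_space)"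
  by (simp add: mu_def)

lemma mu_prob: "borel_probability_on shift_space mu"
  unfolding borel_probability_on_def
  using prob_space_distr[OF measurable_factor_map] space_mu sets_mu by (simp add: mu_def)

lemma AE_factor_map_succ: "AE r in M. factor_map (succ r) = shift (factor_map r)"
proof -
  have "AE r in M. r \<in> residue_space" using AE_space[of M] by (simp only: space_M)
  then show ?thesis using AE_generic by eventually_elim (rule factor_map_succ)
qed

lemma measurable_shift: "shift \<in> measurable (restrict_space borel shift_space) (restrict_space borel shift_space)"
proof (rule measurable_restrict_space2)
  have "shift \<in> measurable borel borel" using continuous_shift by (rule borel_measurable_continuous_onI)
  then show "shift \<in> measurable (restrict_space borel shift_space) borel" by (rule measurable_restrict_space1)
qed (use shift_in_shift_space in \<open>auto simp: space_restrict_space\<close>)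

lemma mu_invariant: "invariant_measure shift mu"
  unfolding invariant_measure_def
proof
  show "shift \<in> measurable mu mu" using measurable_shift sets_mu
    by (simp cong: measurable_cong_sets)
  have "distr mu mu shift = distr mu (restrict_space borel shift_space) shift"
    using sets_mu by (intro distr_cong) auto
  also have "\<dots> = distr M (restrict_space borel shift_space) (shift \<circ> factor_map)"
    unfolding mu_def by (rule distr_distr[OF measurable_shift measurable_factor_map])
  \<comment> \<open>The factor map intertwines \<open>shift\<close> and \<open>succ\<close> only
    almost everywhere, which is enough for image measures.\<close>
  also have "\<dots> = distr M (restrict_space borel shift_space) (factor_map \<circ> succ)"
  proof (rule distr_cong_AE)
    show "AE r in M. (shift \<circ> factor_map) r = (factor_map \<circ> succ) r"
      using AE_factor_map_succ by eventually_elim simp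
  qed (auto intro!: measurable_comp[OF measurable_factor_map measurable_shift] measurable_comp[OF measurable_succ measurable_factor_map])
  also have "\<dots> = distr (distr M M succ) (restrict_space borel shift_space) factor_map"
    by (rule distr_distr[symmetric]) auto
  also have "\<dots> = mu" by (simp add: distr_succ mu_def)
  finally show "distr mu mu shift = mu" .
qed

text \<open>\<open>succ\<close> permutes the cylinders of a given order cyclically, so
  \<open>A\<close> has equal mass in each of them. Hence \<open>A\<close> is independent of all
  cylinders, then of the sigma-algebra they generate, then of itself. Invariance is assumed almost
  everywhere because the factor map is equivariant only there.\<close>

lemma succ_ergodic:
  assumes [measurable]: "A \<in> sets M" and inv: "AE r in M. succ r \<in> A \<longleftrightarrow> r \<in> A"
  shows "prob A = 0 \<or> prob A = 1"
proof -
  have indep: "prob (A \<inter> cyl k a) = prob A * prob (cyl k a)" for k a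
  proof (cases "a < blen k")
    case True
    have step: "prob (A \<inter> cyl k (Suc b mod blen k)) = prob (A \<inter> cyl k b)" if "b < blen k" for b
    proof -
      let ?C = "cyl k (Suc b mod blen k)"
      have "prob (A \<inter> ?C) = measure (distr M M succ) (A \<inter> ?C)" by (simp add: distr_succ)
      also have "\<dots> = prob (succ -` (A \<inter> ?C) \<inter> space M)"
        by (rule measure_distr) auto
      also have "\<dots> = prob (A \<inter> cyl k b)"
      proof (rule measure_eq_AE)
        show "AE r in M. r \<in> succ -` (A \<inter> ?C) \<inter> space M \<longleftrightarrow> r \<in> A \<inter> cyl k b"
          using inv AE_space
        proof eventually_elim
          case (elim r)
          have "succ r \<in> ?C \<longleftrightarrow> r \<in> cyl k b"
            using succ_vimage_cyl[OF that] elim(2) space_M by blast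
          then show ?case using elim by simp
        qed
      qed auto
      finally show ?thesis .
    qed
    have all: "prob (A \<inter> cyl k b) = prob (A \<inter> cyl k 0)" if "b < blen k" for b
      using that
    proof (induction b)
      case (Suc b)
      then show ?case using step[of b] by simp
    qed simp
    have "A \<subseteq> residue_space" using sets.sets_into_space[OF assms(1)] by (simp add: space_M)
    then have "A = (\<Union>b\<in>{..<blen k}. A \<inter> cyl k b)" using residue_space_less by (auto simp: cyl_def)
    then have "prob A = prob (\<Union>b\<in>{..<blen k}. A \<inter> cyl k b)" by (rule arg_cong)
    also have "\<dots> = (\<Sum>b\<in>{..<blen k}. prob (A \<inter> cyl k b))"
    proof (rule finite_measure_finite_Union)
      show "disjoint_family_on (\<lambda>b. A \<inter> cyl k b) {..<blen k}"
        by (auto simp: disjoint_family_on_def cyl_def)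
    qed auto
    also have "\<dots> = (\<Sum>b\<in>{..<blen k}. prob (A \<inter> cyl k a))"
    proof (rule sum.cong)
      fix b assume "b \<in> {..<blen k}"
      then show "prob (A \<inter> cyl k b) = prob (A \<inter> cyl k a)" using all[of b] all[OF True] by simp
    qed simp
    finally show ?thesis using True by (simp add: cyl_measure)
  qed (simp add: cyl_empty)
  have "indep_set {A} cyls"
    using cyl_sets indep by (intro indep_setI) (auto simp: cyls_def)
  then have "indep_set (sigma_sets (space M) {A}) (sigma_sets (space M) cyls)"
    by (intro indep_set_sigma_sets cyls_Int_stable) (auto simp: Int_stable_def)
  moreover have "A \<in> sigma_sets (space M) {A}" "A \<in> sigma_sets (space M) cyls"
    using assms(1) by (auto simp: sets_M space_M)
  ultimately have "prob (A \<inter> A) = prob A * prob A" by (rule indep_setD)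
  then show ?thesis by simp
qed

text \<open>The preimage of an invariant set under the factor map is invariant almost everywhere, so
  ergodicity of the odometer applies.\<close>

lemma mu_ergodic: "ergodic_measure shift mu"
  unfolding ergodic_measure_def
proof (intro conjI mu_invariant ballI impI)
  fix A assume A: "A \<in> sets mu" and inv: "shift -` A \<inter> space mu = A"
  define B where "B = factor_map -` A \<inter> space M"
  have A': "A \<in> sets (restrict_space borel shift_space)" using A sets_mu by simp
  have [measurable]: "B \<in> sets M" unfolding B_def using A' by (rule measurable_sets[OF measurable_factor_map])
  have "AE r in M. succ r \<in> B \<longleftrightarrow> r \<in> B"
    using AE_factor_map_succ AE_space
  proof eventually_elim
    case (elim r)
    have "succ r \<in> space M" using elim(2) succ_in_residue_space by (simp add: space_M)
    moreover have "shift (factor_map r) \<in> A \<longleftrightarrow> factor_map r \<in> A"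
      using inv factor_map_in_shift_space space_mu by blast
    ultimately show ?case using elim by (simp add: B_def)
  qed
  then have "prob B = 0 \<or> prob B = 1" by (intro succ_ergodic) auto
  moreover have "measure mu A = prob B"
    unfolding mu_def B_def by (rule measure_distr[OF measurable_factor_map A'])
  ultimately show "measure mu A = 0 \<or> measure mu A = 1" by simp
qed

text \<open>Entering copy 1 at some stage from \<open>K\<close> on removes at most half of the
  cylinder, as the proportions \<open>1 / branching (K + i)\<close> sum to at most 1/2.\<close>

lemma prob_window_pos:
  assumes "p < blen K"
  shows "prob {r \<in> cyl K p. \<forall>k\<ge>K. r (Suc k) div blen k \<noteq> 1} > 0"
proof -
  define D where "D = (\<lambda>i. cyl K p \<inter> {r \<in> residue_space. r (Suc (K + i)) div blen (K + i) = 1})"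
  have sets: "range D \<subseteq> sets M"
    unfolding D_def by (intro image_subsetI sets.Int cyl_sets digit_1_sets)
  have D_le: "prob (D i) \<le> 1 / (4 * real (blen K)) * (1/2) ^ i" for i
  proof -
    have "prob (D i) \<le> 1 / (real (blen K) * real (branching (K + i)))"
      unfolding D_def by (rule prob_digit_1[OF assms]) simp
    also have "\<dots> \<le> 1 / (real (blen K) * (4 * 2 ^ i))"
    proof (intro divide_left_mono mult_left_mono)
      have "(2::real) ^ (i + 2) \<le> 2 ^ (K + i + 2)" by (intro power_increasing) auto
      then show "4 * 2 ^ i \<le> real (branching (K + i))" by (simp add: branching_def)
    qed (auto simp: branching_def)
    also have "\<dots> = 1 / (4 * real (blen K)) * (1/2) ^ i" by (simp add: power_one_over field_simps)
    finally show ?thesis .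
  qed
  have sum: "summable (\<lambda>i. 1 / (4 * real (blen K)) * (1/2) ^ i)"
    by (intro summable_mult summable_geometric) simp
  then have sumD: "summable (\<lambda>i. prob (D i))"
    by (rule summable_comparison_test') (use D_le in auto)
  have "prob (\<Union>i. D i) \<le> (\<Sum>i. prob (D i))"
    by (rule finite_measure_subadditive_countably[OF sets sumD])
  also have "\<dots> \<le> (\<Sum>i. 1 / (4 * real (blen K)) * (1/2) ^ i)"
    by (rule suminf_le[OF D_le sumD sum])
  also have "\<dots> = 1 / (4 * real (blen K)) * 2"
    by (subst suminf_mult) (auto simp: suminf_geometric)
  also have "\<dots> < 1 / real (blen K)" by (simp add: field_simps)
  finally have less: "prob (\<Union>i. D i) < prob (cyl K p)" using assms by (simp add: cyl_measure)
  have "{r \<in> cyl K p. \<forall>k\<ge>K. r (Suc k) div blen k \<noteq> 1} = cyl K p - (\<Union>i. D i)"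
  proof -
    have "(\<forall>k\<ge>K. P k) \<longleftrightarrow> (\<forall>i. P (K + i))" for P :: "nat \<Rightarrow> bool"
      by (metis le_add1 nat_le_iff_add)
    then show ?thesis by (auto simp: D_def cyl_def)
  qed
  also have "prob \<dots> = prob (cyl K p) - prob (\<Union>i. D i)"
  proof (rule finite_measure_Diff)
    show "(\<Union>i. D i) \<in> sets M" using sets by blast
    show "(\<Union>i. D i) \<subseteq> cyl K p" unfolding D_def by blast
  qed simp
  finally show ?thesis using less by simp
qed

text \<open>An open set that meets the orbit closure contains a tail of \<open>seq\<close>, hence
  all points starting with a long enough window of it. Points of the odometer with residue
  \<open>p\<close> that avoid copy 1 from \<open>K\<close> on read off this window, and they have
  positive probability.\<close>

lemma mu_support: "topological_support shift_space mu = shift_space"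
proof -
  have "emeasure mu (U \<inter> shift_space) > 0" if xU: "x \<in> shift_space" "open U" "x \<in> U" for x U
  proof -
    have "x \<in> closure (range tail_from)" using xU(1) by (simp add: shift_space_def)
    then obtain p where p: "tail_from p \<in> U"
      using open_Int_closure_eq_empty[OF xU(2), of "range tail_from"] xU(3) by blast
    then obtain n \<delta> where n: "\<delta> > 0" "\<And>y. (\<forall>i<n. \<bar>y i - tail_from p i\<bar> \<le> \<delta>) \<Longrightarrow> y \<in> U"
      using open_window[OF xU(2)] by blast
    define K where "K = p + n"
    have K: "p + n < blen K" using less_blen[of K] by (simp add: K_def)
    define W where "W = {r \<in> cyl K p. \<forall>k\<ge>K. r (Suc k) div blen k \<noteq> 1}"
    have UX: "U \<inter> shift_space \<in> sets (restrict_space borel shift_space)"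
      using xU(2) by (auto simp: sets_restrict_space)
    \<comment> \<open>Genericity enters to identify \<open>factor_map\<close> with
      \<open>limit_seq\<close>; the window itself is read off on all of \<open>W\<close>.\<close>
    have "AE r in M. r \<in> W \<longrightarrow> r \<in> factor_map -` (U \<inter> shift_space) \<inter> space M"
      using AE_generic AE_space
    proof eventually_elim
      case (elim r)
      show ?case
      proof
        assume r: "r \<in> W"
        then have "r \<in> residue_space" "r K = p" by (auto simp: W_def cyl_def)
        have "limit_seq r i = tail_from p i" if "i < n" for i
          using limit_seq_eq(2)[OF \<open>r \<in> residue_space\<close>, of K i] r K that \<open>r K = p\<close>
          by (auto simp: W_def tail_from_def)
        then have "limit_seq r \<in> U" using n by simp
        moreover have "factor_map r = limit_seq r"
          using limit_seq_in_shift_space[OF \<open>r \<in> residue_space\<close> elim(1)] by (simp add: factor_map_def)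
        ultimately show "r \<in> factor_map -` (U \<inter> shift_space) \<inter> space M"
          using factor_map_in_shift_space[of r] elim(2) by simp
      qed
    qed
    then have "prob W \<le> prob (factor_map -` (U \<inter> shift_space) \<inter> space M)"
      by (rule finite_measure_mono_AE) (rule measurable_sets[OF measurable_factor_map UX])
    also have "\<dots> = measure mu (U \<inter> shift_space)"
      unfolding mu_def by (rule measure_distr[OF measurable_factor_map UX, symmetric])
    finally have "measure mu (U \<inter> shift_space) > 0"
      using prob_window_pos[of p K] K unfolding W_def by simp
    then show ?thesis unfolding measure_def by (metis enn2real_0 not_gr_zero less_irrefl)
  qed
  then show ?thesis by (auto simp: topological_support_def)
qed

end

theorem mainTheorem5:
  "\<exists>(X :: (nat \<Rightarrow> real) set) (T :: (nat \<Rightarrow> real) \<Rightarrow> (nat \<Rightarrow> real)).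
     X \<noteq> {} \<and>
     top_dyn_system X T \<and>
     topological_entropy X T = 0 \<and>
     everywhere_noninvertible X T \<and>
     (\<exists>\<mu>. borel_probability_on X \<mu> \<and> ergodic_measure T \<mu> \<and> topological_support X \<mu> = X)"
proof -
  obtain M where "odometer M" using odometer_exists by blast
  then interpret odometer M .
  have "shift_space \<noteq> {}" using tail_from_in_shift_space[of 0] by auto
  then show ?thesis
    using shift_space_system shift_space_entropy shift_space_noninvertible mu_prob mu_ergodic mu_support by blast
qed

end
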